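(* Let $\alpha,\beta,\gamma,\delta\ge0$ with $\Gamma:=\gamma\beta+\alpha\gamma+\alpha\delta>0$, and consider the problem $$u''(t)+g(t)f(t,u(t))=0\ (0<t<1),\qquad \alpha u(0)-\beta u'(0)=0,\qquad \gamma u(1)+\delta u'(1)=0.$$ Let $a,b\in[0,1]$ satisfy $-\beta/\alpha<a<b<1+\delta/\gamma$ (with $\beta/\alpha=\infty$ if $\alpha=0$ and $\delta/\gamma=\infty$ if $\gamma=0$), and $c=\min\{(\gamma+\delta-\gamma b)/(\gamma+\delta),\ (\beta+\alpha a)/(\alpha+\beta)\}$. Suppose: (i) $f:[0,1]\times[0,\infty)\to[0,\infty)$ is such that $f(\cdot,u(\cdot))$ is measurable whenever $u\in\mathcal C([0,1])$, and for each $r>0$ there is $R>0$ with $f(t,u)\le R$ for a.a. $t\in[0,1]$ and all $u\in[0,r]$; (ii) there exist admissible discontinuity curves $\gamma_n:I_n=[a_n,b_n]\to[0,\infty)$, $n\in\mathbb N$, such that for a.a. $t\in[0,1]$ the function $u\mapsto f(t,u)$ is continuous on $[0,\infty)\setminus\bigcup_{\{n:\,t\in I_n\}}\{\gamma_n(t)\}$; (iii) $g\in L^1(0,1)$, $g\ge0$ a.e., and $\int_a^bg(s)\,ds>0$. Assume moreover that either (a) there exist $\rho_1,\rho_2\in(0,\infty)$ with $\rho_1/c<\rho_2$ such that $(I^0_{\rho_1})$ and $(I^1_{\rho_2})$ hold, or (b) there exist $\rho_1,\rho_2\in(0,\infty)$ with $\rho_1<\rho_2$ such that $(I^1_{\rho_1})$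 and $(I^0_{\rho_2})$ hold. Then the problem has at least one positive solution $u\in W^{2,1}([0,1])$.
   Context: A solution is a function $u\in\mathcal C^1([0,1])$ with $u'$ absolutely continuous on $[0,1]$ satisfying the equation a.e. and the boundary conditions. The Green's function is $G(t,s)=\frac1\Gamma(\gamma+\delta-\gamma t)(\beta+\alpha s)$ if $0\le s\le t\le1$ and $G(t,s)=\frac1\Gamma(\beta+\alpha t)(\gamma+\delta-\gamma s)$ if $0\le t<s\le1$. Condition $(I^1_\rho)$: there exists $\varepsilon>0$ with $f^{\rho,\varepsilon}<m$, where $f^{\rho,\varepsilon}=\sup_{0\le t\le1,\,0\le u\le\rho+\varepsilon}f(t,u)/\rho$ and $1/m=\sup_{t\in[0,1]}\int_0^1G(t,s)g(s)\,ds$. Condition $(I^0_\rho)$: there exists $\varepsilon>0$ with $f_{\rho,\varepsilon}>M(a,b)$, where $f_{\rho,\varepsilon}=\inf_{a\le t\le b,\ c(\rho-\varepsilon)\le u\le\rho/c+\varepsilon}f(t,u)/\rho$ and $1/M(a,b)=\inf_{t\in[a,b]}\int_a^bG(t,s)g(s)\,ds$. A function $\gamma:[r,s]\subset[0,1]\to[0,\infty)$ with $\gamma\in W^{2,1}([r,s])$ (i.e. $\gamma\in\mathcal C^1$ with $\gamma'$ absolutely continuous) is an admissible discontinuity curve for $u''=-g(t)f(t,u)$ if either (a) $\gamma''(t)=-g(t)f(t,\gamma(t))$ for a.e. $t\in[r,s]$ (viable), or (b) there exist $\varepsilon>0$ and $\psi\in L^1(r,s)$ with $\psi>0$ a.e.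 on $[r,s]$ such that either $\gamma''(t)+\psi(t)<-g(t)f(t,y)$ for a.e. $t\in[r,s]$ and all $y\in[\gamma(t)-\varepsilon,\gamma(t)+\varepsilon]$, or $\gamma''(t)-\psi(t)>-g(t)f(t,y)$ for a.e. $t\in[r,s]$ and all $y\in[\gamma(t)-\varepsilon,\gamma(t)+\varepsilon]$ (inviable). *)

theory Defs
  imports "HOL-Analysis.Analysis"
begin

definition abs_cont_on :: "real \<Rightarrow> real \<Rightarrow> (real \<Rightarrow> real) \<Rightarrow> bool" where
  "abs_cont_on r s h \<longleftrightarrow>
     (\<forall>e>0. \<exists>d>0. \<forall>(n::nat) (x::nat \<Rightarrow> real) (y::nat \<Rightarrow> real).
        (\<forall>i<n. r \<le> x i \<and> x i \<le> y i \<and> y i \<le> s) \<and>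
        (\<forall>i<n. \<forall>j<n. i \<noteq> j \<longrightarrow> y i \<le> x j \<or> y j \<le> x i) \<and>
        (\<Sum>i<n. y i - x i) < d
        \<longrightarrow> (\<Sum>i<n. \<bar>h (y i) - h (x i)\<bar>) < e)"

definition W21_on :: "real \<Rightarrow> real \<Rightarrow> (real \<Rightarrow> real) \<Rightarrow> (real \<Rightarrow> real) \<Rightarrow> bool" where
  "W21_on r s h h' \<longleftrightarrow>
     (\<forall>t\<in>{r..s}. (h has_real_derivative h' t) (at t within {r..s})) \<and>
     continuous_on {r..s} h' \<and> abs_cont_on r s h'"

text \<open>Admissible discontinuity curve gc : [r,s] -> [0,oo) for u'' = - g(t) f(t,u).
  The second derivative gc''(t) is the (a.e. existing) derivative of gc'.
  In the inviable case, y ranges over [gc t - eps, gc t + eps] intersected with the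
  domain [0,oo) of f(t,.).\<close>
definition admissible_curve ::
  "(real \<Rightarrow> real) \<Rightarrow> (real \<Rightarrow> real \<Rightarrow> real) \<Rightarrow> real \<Rightarrow> real \<Rightarrow> (real \<Rightarrow> real) \<Rightarrow> bool" where
  "admissible_curve g f r s gc \<longleftrightarrow>
     r \<le> s \<and> (\<forall>t\<in>{r..s}. gc t \<ge> 0) \<and>
     (\<exists>gc'. W21_on r s gc gc' \<and>
       ((AE t in lebesgue_on {r..s}. (gc' has_real_derivative (- g t * f t (gc t))) (at t))
        \<or>
        (\<exists>eps>0. \<exists>psi. psi absolutely_integrable_on {r..s} \<and>
           (AE t in lebesgue_on {r..s}. psi t > 0) \<and>
           ((AE t in lebesgue_on {r..s}. \<exists>d. (gc' has_real_derivative d) (at t) \<and>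
               (\<forall>y\<in>{gc t - eps..gc t + eps}. y \<ge> 0 \<longrightarrow> d + psi t < - g t * f t y))
            \<or>
            (AE t in lebesgue_on {r..s}. \<exists>d. (gc' has_real_derivative d) (at t) \<and>
               (\<forall>y\<in>{gc t - eps..gc t + eps}. y \<ge> 0 \<longrightarrow> d - psi t > - g t * f t y))))))"

definition green :: "real \<Rightarrow> real \<Rightarrow> real \<Rightarrow> real \<Rightarrow> real \<Rightarrow> real \<Rightarrow> real" where
  "green alpha beta gam delta t s =
     (let Gam = gam * beta + alpha * gam + alpha * delta in
      if s \<le> t then (1 / Gam) * (gam + delta - gam * t) * (beta + alpha * s)
      else (1 / Gam) * (beta + alpha * t) * (gam + delta - gam * s))"

definition m_const :: "real \<Rightarrow> real \<Rightarrow> real \<Rightarrow> real \<Rightarrow> (real \<Rightarrow> real) \<Rightarrow> real" where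
  "m_const alpha beta gam delta g =
     1 / (SUP t\<in>{0..1}. integral {0..1} (\<lambda>s. green alpha beta gam delta t s * g s))"

definition M_const :: "real \<Rightarrow> real \<Rightarrow> real \<Rightarrow> real \<Rightarrow> (real \<Rightarrow> real) \<Rightarrow> real \<Rightarrow> real \<Rightarrow> real" where
  "M_const alpha beta gam delta g a b =
     1 / (INF t\<in>{a..b}. integral {a..b} (\<lambda>s. green alpha beta gam delta t s * g s))"

definition cond_I1 :: "(real \<Rightarrow> real \<Rightarrow> real) \<Rightarrow> real \<Rightarrow> real \<Rightarrow> bool" where
  "cond_I1 f m rho \<longleftrightarrow>
     (\<exists>eps>0. let S = {f t u / rho | t u. 0 \<le> t \<and> t \<le> 1 \<and> 0 \<le> u \<and> u \<le> rho + eps}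
              in bdd_above S \<and> Sup S < m)"

text \<open>Condition (I^0_rho): exists eps > 0 with f_{rho,eps} > M(a,b), where f_{rho,eps} is the
  infimum of f(t,u)/rho over a<=t<=b, c(rho-eps)<=u<=rho/c+eps (u in the domain [0,oo) of f).\<close>
definition cond_I0 :: "(real \<Rightarrow> real \<Rightarrow> real) \<Rightarrow> real \<Rightarrow> real \<Rightarrow> real \<Rightarrow> real \<Rightarrow> real \<Rightarrow> bool" where
  "cond_I0 f a b c M rho \<longleftrightarrow>
     (\<exists>eps>0. let S = {f t u / rho | t u. a \<le> t \<and> t \<le> b \<and> 0 \<le> u \<and>
                          c * (rho - eps) \<le> u \<and> u \<le> rho / c + eps}
              in bdd_below S \<and> Inf S > M)"

end

theory Submission
  imports Defs "HOL-Complex_Analysis.Great_Picard"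
begin

text \<open>
  Degree theory is avoided by a shooting argument. Interpolate \<open>f(t,\<cdot>)\<close> piecewise linearly on a
  grid of mesh \<open>1/N\<close> and freeze the state on time cells of length \<open>1/N\<close>. The initial value problem with
  \<open>u(0) = \<beta>x\<close>, \<open>u'(0) = \<alpha>x\<close> is then solved by a finite recursion, depends continuously on \<open>x \<ge> 0\<close>, and
  satisfies \<open>u = \<integral> G g h + B(x) (\<beta> + \<alpha>t)/\<Gamma>\<close>, where \<open>B(x)\<close> is the defect in the right boundary condition
  and \<open>h\<close> is a convex combination of values of \<open>f\<close> near \<open>u\<close>. When the maximum of \<open>u\<close> equals \<open>\<rho>\<close>,
  condition \<open>(I\<^sup>1)\<close> at \<open>\<rho>\<close> forces \<open>B(x) > 0\<close> and condition \<open>(I\<^sup>0)\<close> at \<open>\<rho>\<close> forces \<open>B(x) < 0\<close>. The intermediate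
  value theorem, applied on a parameter interval on which the maximum runs from \<open>\<rho>\<^sub>1\<close> to \<open>\<rho>\<^sub>2\<close> without
  leaving \<open>[\<rho>\<^sub>1, \<rho>\<^sub>2]\<close>, gives \<open>B(x) = 0\<close>; this treats (a) and (b) alike.

  As \<open>N \<rightarrow> \<infinity>\<close> the approximations converge in \<open>C\<^sup>1\<close> along a subsequence. Where the limit \<open>u\<close> avoids all
  discontinuity curves, \<open>h\<close> converges pointwise to \<open>f(t,u(t))\<close>. On the contact set with a curve \<open>y\<close> one
  has \<open>u'' = y''\<close> a.e.; for a viable curve this is the equation, for an inviable one it contradicts the
  bounds on \<open>g h\<close>, so the contact set is null.
\<close>


section \<open>Lebesgue points and absolute continuity\<close>

text \<open>The obstacle is that \<open>f t\<close> may jump, so the initial value problem for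
  \<open>f\<close> itself need not have unique solutions or depend continuously on its data.
  Interpolation restores continuity in the state; freezing makes each node value depend on earlier
  nodes only, so no fixed point theorem enters. The chosen initial data satisfy the left boundary
  condition for every \<open>x\<close>, which leaves one scalar unknown. The signs of
  \<open>B\<close> come from evaluating the representation at grid nodes. If
  \<open>B \<le> 0\<close> under the upper condition, the Green term alone would have to reach
  \<rho> at the maximum, but it is strictly smaller. If \<open>B \<ge> 0\<close> under the lower
  condition, kernel and line \<open>beta + alpha * t\<close> obey the same cone inequality, so the
  solution is at least \<open>c\<close> times its maximum on \<open>[a,b]\<close>, and the Green
  term there exceeds that maximum. The slack in both conditions absorbs the errors of interpolation
  and freezing, which are of order \<open>1/N\<close>. In the limit \<open>g h\<close> need not
  converge at contact points; only its primitives do. Their limit is therefore compared with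
  primitives of tail suprema and infima, which are differentiable almost everywhere.\<close>

lemma AE_lebesgue_on_iff_negligible:
  fixes S :: "'a::euclidean_space set"
  assumes "S \<in> sets lebesgue"
  shows "(AE t in lebesgue_on S. P t) \<longleftrightarrow> (\<exists>N. negligible N \<and> (\<forall>t\<in>S - N. P t))"
proof -
  have "(AE t in lebesgue_on S. P t) \<longleftrightarrow> (AE t in lebesgue. t \<in> S \<longrightarrow> P t)"
    using assms by (simp add: AE_restrict_space_iff)
  also have "\<dots> \<longleftrightarrow> (\<exists>N. negligible N \<and> {t. \<not> (t \<in> S \<longrightarrow> P t)} \<subseteq> N)"
    by (rule eventually_ae_filter_negligible)
  also have "\<dots> \<longleftrightarrow> (\<exists>N. negligible N \<and> (\<forall>t\<in>S - N. P t))"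
    by blast
  finally show ?thesis .
qed

lemma integral_diff_real:
  fixes k :: "real \<Rightarrow> real"
  assumes "k integrable_on {p..q}" "p \<le> s" "s \<le> t" "t \<le> q"
  shows "integral {p..t} k - integral {p..s} k = integral {s..t} k"
proof -
  have "k integrable_on {p..t}"
    using assms by (auto intro: integrable_on_subinterval)
  then show ?thesis
    using Henstock_Kurzweil_Integration.integral_combine[of p s t k] assms by simp
qed

text \<open>The library fact yields only right-hand difference quotients off a null set. Applying it
  also to the reflected function supplies the left-hand ones. Extension by zero to \<open>K\<close>
  provides the integrability on every interval that the fact demands.\<close>

lemma integral_has_real_derivative_AE:
  fixes k :: "real \<Rightarrow> real"
  assumes k: "k integrable_on {p..q}"
  obtains N where "negligible N"
    "\<And>t. t \<in> {p<..<q} - N \<Longrightarrow> ((\<lambda>x. integral {p..x} k) has_real_derivative k t) (at t)"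
proof -
  define K where "K x = (if x \<in> {p..q} then k x else 0)" for x
  have K: "K integrable_on cbox a b" for a b
  proof -
    have "K integrable_on UNIV"
      using k unfolding K_def by (simp only: integrable_restrict_UNIV)
    then show ?thesis by (rule integrable_on_subcbox) simp
  qed
  obtain N1 where N1: "negligible N1"
    "\<And>x e. \<lbrakk>x \<notin> N1; 0 < e\<rbrakk> \<Longrightarrow> \<exists>d>0. \<forall>h. 0 < h \<and> h < d \<longrightarrow> \<bar>integral {x..x+h} K / h - K x\<bar> < e"
    using integrable_ccontinuous_explicit[OF K] by (auto simp: field_simps)
  have "(\<lambda>x. K (- x)) integrable_on cbox a b" for a b
    using K[of "-b" "-a"] by (metis integrable_reflect minus_minus)
  then obtain N2 where N2: "negligible N2"
    "\<And>x e. \<lbrakk>x \<notin> N2; 0 < e\<rbrakk> \<Longrightarrow> \<exists>d>0. \<forall>h. 0 < h \<and> h < d \<longrightarrow> \<bar>integral {x..x+h} (\<lambda>x. K (-x)) / h - K (-x)\<bar> < e"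
    using integrable_ccontinuous_explicit[of "\<lambda>x. K (- x)"] by (auto simp: field_simps)
  have "negligible (uminus ` N2)"
    using N2(1) by (intro negligible_differentiable_image_negligible)
      (auto intro: derivative_intros)
  then have neg: "negligible (N1 \<union> uminus ` N2)"
    using N1(1) by (rule negligible_Un[rotated])
  show thesis
  proof (rule that[OF neg])
    fix t assume t: "t \<in> {p<..<q} - (N1 \<union> uminus ` N2)"
    then have t1: "t \<notin> N1" "- t \<notin> N2" "p < t" "t < q"
      by force+
    have Kt: "K t = k t" using t by (auto simp: K_def)
    show "((\<lambda>x. integral {p..x} k) has_real_derivative k t) (at t)"
      unfolding DERIV_def
    proof (rule LIM_I)
      fix e :: real assume e: "0 < e"
      obtain d1 where d1: "d1 > 0" "\<And>h. 0 < h \<Longrightarrow> h < d1 \<Longrightarrow> \<bar>integral {t..t+h} K / h - K t\<bar> < e"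
        using N1(2)[OF t1(1) e] by blast
      obtain d2 where d2: "d2 > 0" "\<And>h. 0 < h \<Longrightarrow> h < d2 \<Longrightarrow> \<bar>integral {-t..-t+h} (\<lambda>x. K (-x)) / h - K t\<bar> < e"
        using N2(2)[OF t1(2) e] by auto
      define d where "d = min (min d1 d2) (min (q - t) (t - p))"
      have "d > 0" using d1 d2 t1 by (auto simp: d_def)
      moreover have "\<bar>(integral {p..t+h} k - integral {p..t} k) / h - k t\<bar> < e" if h: "h \<noteq> 0" "\<bar>h\<bar> < d" for h
      proof (cases "h > 0")
        case True
        have "integral {p..t+h} k - integral {p..t} k = integral {t..t+h} k"
          using h True t1 by (intro integral_diff_real[OF k]) (auto simp: d_def)
        also have "\<dots> = integral {t..t+h} K"
          using h True t1 by (intro integral_cong) (auto simp: d_def K_def)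
        finally show ?thesis using d1(2)[of h] True h Kt by (auto simp: d_def)
      next
        case False
        then have h0: "0 < -h" using h by auto
        have "integral {p..t} k - integral {p..t+h} k = integral {t+h..t} k"
          using h h0 t1 by (intro integral_diff_real[OF k]) (auto simp: d_def)
        also have "\<dots> = integral {t+h..t} K"
          using h h0 t1 by (intro integral_cong) (auto simp: d_def K_def)
        also have "\<dots> = integral {-t..-t+(-h)} (\<lambda>x. K (-x))"
          using Henstock_Kurzweil_Integration.integral_reflect_real[of t "t+h" K] by simp
        finally have eq: "(integral {p..t+h} k - integral {p..t} k) / h = integral {-t..-t+(-h)} (\<lambda>x. K (-x)) / (-h)"
          using h by (simp add: field_simps)
        show ?thesis unfolding eq using d2(2)[OF h0] h h0 Kt by (auto simp: d_def)
      qed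
      ultimately show "\<exists>d>0. \<forall>x. x \<noteq> 0 \<and> norm (x - 0) < d \<longrightarrow>
          norm ((integral {p..t + x} k - integral {p..t} k) / x - k t) < e"
        by auto
    qed
  qed
qed

text \<open>Truncate \<open>G\<close> at height \<open>n\<close>: by dominated convergence the
  excess over the truncation has integral below \<open>e\<close> for some \<open>n\<close>. This is
  the absolute continuity of the integral in the form used next.\<close>

lemma absolutely_integrable_almost_bounded:
  fixes G :: "real \<Rightarrow> real"
  assumes G: "G absolutely_integrable_on {r..s}" and G0: "\<And>t. t \<in> {r..s} \<Longrightarrow> 0 \<le> G t"
    and e: "0 < e"
  obtains M H where "0 \<le> M" "H integrable_on {r..s}" "\<And>t. t \<in> {r..s} \<Longrightarrow> 0 \<le> H t"
     "integral {r..s} H < e" "\<And>t. t \<in> {r..s} \<Longrightarrow> G t \<le> M + H t"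
proof -
  have Gi: "G integrable_on {r..s}" using G by (rule absolutely_integrable_on_def[THEN iffD1, THEN conjunct1])
  have min_int: "(\<lambda>t. min (G t) (real n)) integrable_on {r..s}" for n
  proof -
    have "(\<lambda>t. real n) absolutely_integrable_on {r..s}"
      by (simp add: absolutely_integrable_on_const)
    then have "(\<lambda>t. min (G t) (real n)) absolutely_integrable_on {r..s}"
      using G by (intro absolutely_integrable_min_1)
    then show ?thesis using absolutely_integrable_on_def by blast
  qed
  have "(\<lambda>n. integral {r..s} (\<lambda>t. min (G t) (real n))) \<longlonglongrightarrow> integral {r..s} G"
  proof (rule dominated_convergence(2)[of _ _ G])
    show "norm (min (G x) (real n)) \<le> G x" if "x \<in> {r..s}" for x n
      using G0[OF that] by auto
    show "(\<lambda>n. min (G x) (real n)) \<longlonglongrightarrow> G x" if "x \<in> {r..s}" for x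
    proof (rule tendsto_eventually)
      obtain m where "G x \<le> real m" using real_arch_simple by blast
      then show "\<forall>\<^sub>F n in sequentially. min (G x) (real n) = G x"
        by (auto simp: eventually_sequentially intro!: exI[of _ m])
    qed
  qed (use Gi min_int in auto)
  then obtain n where n: "integral {r..s} G - integral {r..s} (\<lambda>t. min (G t) (real n)) < e"
    using e by (metis (no_types, lifting) LIMSEQ_iff abs_minus_commute abs_less_iff order_refl real_norm_def)
  show thesis
  proof (rule that[of "real n" "\<lambda>t. G t - min (G t) (real n)"])
    show "(\<lambda>t. G t - min (G t) (real n)) integrable_on {r..s}"
      using Gi min_int by (rule integrable_diff)
    show "integral {r..s} (\<lambda>t. G t - min (G t) (real n)) < e"
      using n Henstock_Kurzweil_Integration.integral_diff[OF Gi min_int[of n]] by linarith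
  qed auto
qed

text \<open>In the bound \<open>M + H\<close> for \<open>G\<close>, the constant costs
  \<open>M\<close> times the total length of the intervals, while \<open>H\<close> costs at most its
  integral over all of \<open>[r,s]\<close>, however the intervals are placed.\<close>

lemma abs_cont_on_dominated:
  fixes w G :: "real \<Rightarrow> real"
  assumes G: "G absolutely_integrable_on {r..s}" and G0: "\<And>t. t \<in> {r..s} \<Longrightarrow> 0 \<le> G t"
    and w: "\<And>x y. r \<le> x \<Longrightarrow> x \<le> y \<Longrightarrow> y \<le> s \<Longrightarrow> \<bar>w y - w x\<bar> \<le> integral {x..y} G"
  shows "abs_cont_on r s w"
  unfolding abs_cont_on_def
proof (intro allI impI)
  fix e :: real assume e: "0 < e"
  have Gi: "G integrable_on {r..s}" using G absolutely_integrable_on_def by blast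
  obtain M H where M: "0 \<le> M" and H: "H integrable_on {r..s}" "\<And>t. t \<in> {r..s} \<Longrightarrow> 0 \<le> H t"
     "integral {r..s} H < e/2" and GM: "\<And>t. t \<in> {r..s} \<Longrightarrow> G t \<le> M + H t"
    using absolutely_integrable_almost_bounded[OF G G0, of "e/2"] e by auto
  \<comment> \<open>The \<open>+ 1\<close> covers \<open>M = 0\<close>; the constant part then
    contributes at most \<open>e/2\<close>.\<close>
  define d where "d = e / (2 * (M + 1))"
  have d: "d > 0" using e M by (auto simp: d_def)
  have "(\<Sum>i<n. \<bar>w (y i) - w (x i)\<bar>) < e"
    if xy: "\<And>i. i < n \<Longrightarrow> r \<le> x i \<and> x i \<le> y i \<and> y i \<le> s"
      and disj: "\<And>i j. i < n \<Longrightarrow> j < n \<Longrightarrow> i \<noteq> j \<Longrightarrow> y i \<le> x j \<or> y j \<le> x i"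
      and len: "(\<Sum>i<n. y i - x i) < d" for n and x y :: "nat \<Rightarrow> real"
  proof -
    have Hi: "H integrable_on {x i..y i}" if "i < n" for i
      using H(1) xy[OF that] by (auto intro: integrable_on_subinterval)
    have "(\<Sum>i<n. \<bar>w (y i) - w (x i)\<bar>) \<le> (\<Sum>i<n. M * (y i - x i) + integral {x i..y i} H)"
    proof (rule sum_mono)
      fix i assume "i \<in> {..<n}" then have i: "i < n" by simp
      have "\<bar>w (y i) - w (x i)\<bar> \<le> integral {x i..y i} G" using w xy[OF i] by blast
      also have "\<dots> \<le> integral {x i..y i} (\<lambda>t. M + H t)"
        using xy[OF i] GM by (intro integral_le integrable_on_subinterval[OF Gi] integrable_add Hi[OF i]) auto
      also have "\<dots> = M * (y i - x i) + integral {x i..y i} H"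
        using xy[OF i] Hi[OF i] by (subst Henstock_Kurzweil_Integration.integral_add) auto
      finally show "\<bar>w (y i) - w (x i)\<bar> \<le> M * (y i - x i) + integral {x i..y i} H" .
    qed
    also have "\<dots> = M * (\<Sum>i<n. y i - x i) + (\<Sum>i<n. integral {x i..y i} H)"
      by (simp add: sum.distrib sum_distrib_left)
    also have "(\<Sum>i<n. integral {x i..y i} H) \<le> integral {r..s} H"
    proof -
      \<comment> \<open>Intervals may touch, so additivity of the integral needs overlaps that are
        null rather than empty.\<close>
      have "negligible ({x i..y i} \<inter> {x j..y j})" if "i < n" "j < n" "i \<noteq> j" for i j
      proof (rule negligible_subset[of "{x i, x j, y i, y j}"])
        show "{x i..y i} \<inter> {x j..y j} \<subseteq> {x i, x j, y i, y j}"
          using disj[OF that] by auto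
      qed (simp add: negligible_finite)
      then have "(H has_integral (\<Sum>i<n. integral {x i..y i} H)) (\<Union>i<n. {x i..y i})"
        using Hi by (intro has_integral_UN) (auto simp: pairwise_def)
      then show ?thesis
        using H xy by (intro has_integral_subset_le[of "\<Union>i<n. {x i..y i}" "{r..s}" H]) fastforce+
    qed
    also have "M * (\<Sum>i<n. y i - x i) \<le> M * d"
      using len M by (intro mult_left_mono) auto
    also have "\<dots> \<le> e / 2" using M e by (auto simp: d_def field_simps)
    finally show ?thesis using H(3) by simp
  qed
  then show "\<exists>d>0. \<forall>(n::nat) x y. (\<forall>i<n. r \<le> x i \<and> x i \<le> y i \<and> y i \<le> s) \<and>
        (\<forall>i<n. \<forall>j<n. i \<noteq> j \<longrightarrow> y i \<le> x j \<or> y j \<le> x i) \<and> (\<Sum>i<n. y i - x i) < d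
        \<longrightarrow> (\<Sum>i<n. \<bar>w (y i) - w (x i)\<bar>) < e"
    using d by (intro exI[of _ d]) blast
qed


section \<open>Contact sets\<close>

lemma has_real_derivative_at_alt:
  fixes f :: "real \<Rightarrow> real"
  shows "(f has_real_derivative D) (at x) \<longleftrightarrow>
    (\<forall>e>0. \<exists>d>0. \<forall>y. \<bar>y - x\<bar> < d \<longrightarrow> \<bar>f y - f x - D * (y - x)\<bar> \<le> e * \<bar>y - x\<bar>)"
  by (simp add: has_field_derivative_def has_derivative_at_alt bounded_linear_mult_right)

lemma integrable_on_indicator_mult:
  fixes G :: "real \<Rightarrow> real"
  assumes "G absolutely_integrable_on {r..s}" "A \<in> sets lebesgue"
  shows "(\<lambda>t. indicator A t * G t) integrable_on {r..s}"
proof -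
  have "G absolutely_integrable_on A \<inter> {r..s}"
    using assms by (intro set_integrable_subset[OF assms(1)]) auto
  then have "G integrable_on A \<inter> {r..s}"
    using absolutely_integrable_on_def by blast
  then have "(\<lambda>t. if t \<in> A then G t else 0) integrable_on {r..s}"
    by (simp add: integrable_restrict_Int)
  then show ?thesis
    by (rule integrable_eq) (auto simp: indicator_def)
qed

text \<open>The point of \<open>D\<close> between \<open>t\<close> and \<open>x\<close> that is
  closest to \<open>x\<close>. It serves as an intermediate station at which two functions agreeing
  on \<open>D\<close> can be exchanged.\<close>

lemma nearest_point_between:
  fixes D :: "real set"
  assumes "closed D" "t \<in> D"
  obtains t' where "t' \<in> D" "min t x \<le> t'" "t' \<le> max t x" "D \<inter> {min t' x<..<max t' x} = {}"
proof (cases "t \<le> x")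
  case True
  have "compact (D \<inter> {t..x})" "D \<inter> {t..x} \<noteq> {}" using assms True by (auto intro: closed_Int_compact)
  then obtain t' where "t' \<in> D \<inter> {t..x}" "\<forall>z\<in>D \<inter> {t..x}. z \<le> t'"
    using compact_attains_sup by metis
  then have t': "t' \<in> D" "t \<le> t'" "t' \<le> x" "\<And>z. z \<in> D \<Longrightarrow> z \<le> x \<Longrightarrow> z \<le> t'"
    using True by (auto intro: order_trans linear)
  then have "D \<inter> {min t' x<..<max t' x} = {}" by (auto simp: not_less[symmetric])
  with t' show ?thesis using that[of t'] True by auto
next
  case False
  have "compact (D \<inter> {x..t})" "D \<inter> {x..t} \<noteq> {}" using assms False by (auto intro: closed_Int_compact)
  then obtain t' where "t' \<in> D \<inter> {x..t}" "\<forall>z\<in>D \<inter> {x..t}. t' \<le> z"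
    using compact_attains_inf by metis
  then have t': "t' \<in> D" "x \<le> t'" "t' \<le> t" "\<And>z. z \<in> D \<Longrightarrow> x \<le> z \<Longrightarrow> t' \<le> z"
    using False by (auto intro: order_trans linear)
  then have "D \<inter> {min t' x<..<max t' x} = {}" by (auto simp: not_less[symmetric])
  with t' show ?thesis using that[of t'] False by auto
qed

text \<open>On the gap the indicator of \<open>A\<close> is 1, so the mass of \<open>G\<close> there
  is part of the increment of the primitive of the restricted function. With \<open>G = 1\<close>
  this bounds the length of the gap.\<close>

lemma gap_le_primitive:
  fixes G :: "real \<Rightarrow> real"
  assumes G: "G absolutely_integrable_on {r..s}" and G0: "\<And>t. t \<in> {r..s} \<Longrightarrow> 0 \<le> G t"
    and A: "A \<in> sets lebesgue"
    and x: "x \<in> {r..s}" "t \<in> {r..s}" and t': "min t x \<le> t'" "t' \<le> max t x"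
    and gap: "{min t' x<..<max t' x} \<subseteq> A"
  shows "integral {min t' x..max t' x} G \<le>
     \<bar>integral {r..x} (\<lambda>t. indicator A t * G t) - integral {r..t} (\<lambda>t. indicator A t * G t)\<bar>"
proof -
  let ?H = "\<lambda>t. indicator A t * G t"
  have H: "?H integrable_on {r..s}" by (rule integrable_on_indicator_mult[OF G A])
  have Gi: "G integrable_on {r..s}" using G absolutely_integrable_on_def by blast
  have sub: "{min t x..max t x} \<subseteq> {r..s}" "{min t' x..max t' x} \<subseteq> {min t x..max t x}"
    using x t' by auto
  have "integral {min t' x..max t' x} G = integral {min t' x..max t' x} ?H"
    by (rule integral_spike[of "{min t' x, max t' x}"]) (use gap in \<open>auto simp: indicator_def subset_iff\<close>)
  also have "\<dots> \<le> integral {min t x..max t x} ?H"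
    using sub by (intro integral_subset_le integrable_on_subinterval[OF H]) (auto intro!: mult_nonneg_nonneg G0)
  also have "\<dots> = integral {r..max t x} ?H - integral {r..min t x} ?H"
    using x by (intro integral_diff_real[OF H, symmetric]) auto
  also have "\<dots> \<le> \<bar>integral {r..x} ?H - integral {r..t} ?H\<bar>"
    by (auto simp: max_def min_def)
  finally show ?thesis .
qed

text \<open>On the contact set the two functions have the same derivative except at isolated points.
  At a density point of the set where both values and derivatives agree, every nearby point is
  within a relatively negligible gap of that set, which transfers the derivative of \<open>y'\<close> to \<open>v'\<close>.\<close>

lemma second_derivative_eq_on_contact_set:
  fixes v v' y y' G :: "real \<Rightarrow> real"
  assumes v: "\<And>t. t \<in> {r..s} \<Longrightarrow> (v has_real_derivative v' t) (at t within {r..s})"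
    and y: "\<And>t. t \<in> {r..s} \<Longrightarrow> (y has_real_derivative y' t) (at t within {r..s})"
    and v'c: "continuous_on {r..s} v'" and y'c: "continuous_on {r..s} y'"
    and G: "G absolutely_integrable_on {r..s}" and G0: "\<And>t. t \<in> {r..s} \<Longrightarrow> 0 \<le> G t"
    and v'G: "\<And>a b. r \<le> a \<Longrightarrow> a \<le> b \<Longrightarrow> b \<le> s \<Longrightarrow> \<bar>v' b - v' a\<bar> \<le> integral {a..b} G"
  obtains N where "negligible N"
    "\<And>t d. t \<in> {r..s} - N \<Longrightarrow> v t = y t \<Longrightarrow> (y' has_real_derivative d) (at t) \<Longrightarrow> (v' has_real_derivative d) (at t)"
proof -
  define E where "E = {t\<in>{r..s}. v t - y t = 0}"
  define D where "D = {t\<in>E. v' t - y' t = 0}"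
  have vc: "continuous_on {r..s} v" "continuous_on {r..s} y"
    using v y DERIV_continuous_on by blast+
  have E: "closed E"
    unfolding E_def by (intro continuous_closed_preimage_constant continuous_intros vc closed_real_atLeastAtMost)
  have D: "closed D" 
  proof -
    have "closed {t\<in>{r..s}. v' t - y' t = 0}"
      by (intro continuous_closed_preimage_constant continuous_intros v'c y'c closed_real_atLeastAtMost)
    moreover have "D = E \<inter> {t\<in>{r..s}. v' t - y' t = 0}" by (auto simp: D_def E_def)
    ultimately show ?thesis using E by auto
  qed
  have one: "(\<lambda>t. 1::real) absolutely_integrable_on {r..s}"
    by (simp add: absolutely_integrable_on_const)
  have Em: "E \<in> sets lebesgue" and Dm: "- D \<in> sets lebesgue"
    using E D by (auto intro: borel_closed borel_open)
  \<comment> \<open>\<open>C\<close> measures the length and \<open>Z\<close> the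
    \<open>G\<close>-mass of the complement of \<open>D\<close>. Off null sets both have derivative
    zero at points of \<open>D\<close>, so both masses are \<open>o(|x - t|)\<close>.\<close>
  define C where "C x = integral {r..x} (\<lambda>t. indicator (-D) t * 1 :: real)" for x
  define Z where "Z x = integral {r..x} (\<lambda>t. indicator (-D) t * G t)" for x
  obtain N1 where N1: "negligible N1" "\<And>t. t \<in> {r<..<s} - N1 \<Longrightarrow>
      ((\<lambda>x. integral {r..x} (\<lambda>t. indicator E t * 1 :: real)) has_real_derivative indicator E t * 1) (at t)"
    using integral_has_real_derivative_AE[OF integrable_on_indicator_mult[OF one Em]] by blast
  obtain N2 where N2: "negligible N2" "\<And>t. t \<in> {r<..<s} - N2 \<Longrightarrow>
      (C has_real_derivative indicator (-D) t * 1) (at t)"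
    using integral_has_real_derivative_AE[OF integrable_on_indicator_mult[OF one Dm]] unfolding C_def by blast
  obtain N3 where N3: "negligible N3" "\<And>t. t \<in> {r<..<s} - N3 \<Longrightarrow>
      (Z has_real_derivative indicator (-D) t * G t) (at t)"
    using integral_has_real_derivative_AE[OF integrable_on_indicator_mult[OF G Dm]] unfolding Z_def by blast
  have neg: "negligible (N1 \<union> N2 \<union> N3 \<union> {r, s})"
    using N1 N2 N3 by (intro negligible_Un) auto
  show thesis
  proof (rule that[OF neg])
    fix t d assume t: "t \<in> {r..s} - (N1 \<union> N2 \<union> N3 \<union> {r, s})" and vy: "v t = y t"
      and d: "(y' has_real_derivative d) (at t)"
    have rts: "r < t" "t < s" using t by auto
    have tE: "t \<in> E" using t vy by (auto simp: E_def)
    have tD: "t \<in> D"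
    proof (rule ccontr)
      \<comment> \<open>Different slopes would make \<open>t\<close> an isolated point of
        \<open>E\<close>. The primitive of the indicator of \<open>E\<close> would then be constant
        just to the right of \<open>t\<close>, against its derivative 1 there.\<close>
      assume "t \<notin> D"
      then have ne: "v' t - y' t \<noteq> 0" using tE by (auto simp: D_def)
      have "(v has_real_derivative v' t) (at t)" "(y has_real_derivative y' t) (at t)"
        using v[of t] y[of t] rts by (simp_all add: at_within_Icc_at)
      then have "((\<lambda>x. v x - y x) has_real_derivative v' t - y' t) (at t)"
        by (intro derivative_intros)
      then have "((\<lambda>x. ((v x - y x) - (v t - y t)) / (x - t)) \<longlongrightarrow> v' t - y' t) (at t)"
        by (simp add: has_field_derivative_iff)
      then have "\<forall>\<^sub>F x in at t. ((v x - y x) - (v t - y t)) / (x - t) \<noteq> 0"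
        using ne by (rule tendsto_imp_eventually_ne)
      then have "\<forall>\<^sub>F x in at t. x \<notin> E"
        by eventually_elim (auto simp: vy E_def)
      then obtain \<delta> where \<delta>: "\<delta> > 0" "\<And>x. x \<noteq> t \<Longrightarrow> \<bar>x - t\<bar> < \<delta> \<Longrightarrow> x \<notin> E"
        by (auto simp: eventually_at dist_real_def)
      let ?I = "\<lambda>x. integral {r..x} (\<lambda>t. indicator E t * 1 :: real)"
      have "(?I has_real_derivative 1) (at t)"
        using N1(2)[of t] t rts tE by simp
      then obtain \<eta> where \<eta>: "\<eta> > 0" "\<And>x. \<bar>x - t\<bar> < \<eta> \<Longrightarrow> \<bar>?I x - ?I t - 1 * (x - t)\<bar> \<le> 1/2 * \<bar>x - t\<bar>"
        unfolding has_real_derivative_at_alt by (metis half_gt_zero_iff zero_less_one)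
      define x where "x = t + min (min \<delta> \<eta>) (s - t) / 2"
      have x: "t < x" "x < s" "\<bar>x - t\<bar> < \<eta>" "\<bar>x - t\<bar> < \<delta>"
        using \<delta>(1) \<eta>(1) rts by (auto simp: x_def min_def field_simps)
      have "?I x - ?I t = integral {t..x} (\<lambda>t. indicator E t * 1 :: real)"
        using x rts by (intro integral_diff_real[OF integrable_on_indicator_mult[OF one Em]]) auto
      also have "\<dots> = integral {t..x} (\<lambda>t. 0)"
        by (rule integral_spike[of "{t}"]) (use \<delta>(2) x in \<open>auto simp: indicator_def\<close>)
      finally have "?I x - ?I t = 0" by simp
      then show False using \<eta>(2)[of x] x by auto
    qed
    have dC: "(C has_real_derivative 0) (at t)" and dZ: "(Z has_real_derivative 0) (at t)"
      using N2(2)[of t] N3(2)[of t] t rts tD by auto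
    have "((\<lambda>x. v' x - y' x) has_real_derivative 0) (at t)"
      unfolding has_real_derivative_at_alt
    proof (intro allI impI)
      fix e :: real assume e: "0 < e"
      \<comment> \<open>Three error terms of size \<open>\<epsilon> * |x - t|\<close> and one of
        size \<open>|d|\<close> times that are collected below; \<open>4 + |d|\<close> exceeds their
        number.\<close>
      define \<epsilon> where "\<epsilon> = e / (4 + \<bar>d\<bar>)"
      have \<epsilon>: "\<epsilon> > 0" using e by (auto simp: \<epsilon>_def intro!: divide_pos_pos)
      obtain d1 where d1: "d1 > 0" "\<And>x. \<bar>x - t\<bar> < d1 \<Longrightarrow> \<bar>C x - C t\<bar> \<le> \<epsilon> * \<bar>x - t\<bar>"
        using dC \<epsilon> unfolding has_real_derivative_at_alt by (metis diff_zero mult_zero_left)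
      obtain d2 where d2: "d2 > 0" "\<And>x. \<bar>x - t\<bar> < d2 \<Longrightarrow> \<bar>Z x - Z t\<bar> \<le> \<epsilon> * \<bar>x - t\<bar>"
        using dZ \<epsilon> unfolding has_real_derivative_at_alt by (metis diff_zero mult_zero_left)
      obtain d3 where d3: "d3 > 0" "\<And>x. \<bar>x - t\<bar> < d3 \<Longrightarrow> \<bar>y' x - y' t - d * (x - t)\<bar> \<le> \<epsilon> * \<bar>x - t\<bar>"
        using d \<epsilon> unfolding has_real_derivative_at_alt by metis
      define \<delta> where "\<delta> = min (min d1 d2) (min d3 (min (t - r) (s - t)))"
      have "\<delta> > 0" using d1 d2 d3 rts by (auto simp: \<delta>_def)
      moreover have "\<bar>(v' x - y' x) - (v' t - y' t) - 0 * (x - t)\<bar> \<le> e * \<bar>x - t\<bar>" if x: "\<bar>x - t\<bar> < \<delta>" for x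
      proof -
        have xrs: "x \<in> {r..s}" "t \<in> {r..s}" using x rts by (auto simp: \<delta>_def)
        obtain t' where t': "t' \<in> D" "min t x \<le> t'" "t' \<le> max t x" "D \<inter> {min t' x<..<max t' x} = {}"
          using nearest_point_between[OF D tD] by blast
        then have gap: "{min t' x<..<max t' x} \<subseteq> - D" by auto
        have t'x: "\<bar>t' - t\<bar> \<le> \<bar>x - t\<bar>" using t' by (auto simp: min_def max_def split: if_splits)
        have "integral {min t' x..max t' x} (\<lambda>_. 1::real) \<le> \<bar>C x - C t\<bar>"
          unfolding C_def by (rule gap_le_primitive[OF one _ Dm xrs t'(2,3) gap]) simp
        then have "\<bar>x - t'\<bar> \<le> \<bar>C x - C t\<bar>"
          by (simp add: max_def min_def split: if_splits)
        then have a1: "\<bar>x - t'\<bar> \<le> \<epsilon> * \<bar>x - t\<bar>"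
          using d1(2)[of x] x by (auto simp: \<delta>_def)
        have "\<bar>v' (max t' x) - v' (min t' x)\<bar> \<le> integral {min t' x..max t' x} G"
          using xrs t' by (intro v'G) auto
        also have "\<dots> \<le> \<bar>Z x - Z t\<bar>"
          unfolding Z_def by (rule gap_le_primitive[OF G G0 Dm xrs t'(2,3) gap])
        finally have a2: "\<bar>v' x - v' t'\<bar> \<le> \<epsilon> * \<bar>x - t\<bar>"
          using d2(2)[of x] x by (auto simp: \<delta>_def max_def min_def abs_minus_commute split: if_splits)
        have a3: "\<bar>y' x - y' t - d * (x - t)\<bar> \<le> \<epsilon> * \<bar>x - t\<bar>"
          using d3(2)[of x] x by (auto simp: \<delta>_def)
        have "\<bar>y' t' - y' t - d * (t' - t)\<bar> \<le> \<epsilon> * \<bar>t' - t\<bar>"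
          using d3(2)[of t'] x t'x by (auto simp: \<delta>_def)
        also have "\<dots> \<le> \<epsilon> * \<bar>x - t\<bar>" using t'x \<epsilon> by (intro mult_left_mono) auto
        finally have a4: "\<bar>y' t' - y' t - d * (t' - t)\<bar> \<le> \<epsilon> * \<bar>x - t\<bar>" .
        have a5: "\<bar>d * (x - t')\<bar> \<le> \<bar>d\<bar> * (\<epsilon> * \<bar>x - t\<bar>)"
          unfolding abs_mult using a1 by (intro mult_left_mono) auto
        have eq: "v' t' = y' t'" "v' t = y' t" using t' tD by (auto simp: D_def)
        \<comment> \<open>Since \<open>v'\<close> and \<open>y'\<close> agree at \<open>t\<close>
          and \<open>t'\<close>, what remains is the change of \<open>v'\<close> across the gap, two
          first order remainders of \<open>y'\<close> at \<open>t\<close>, and the slope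
          \<open>d\<close> times the gap length.\<close>
        have "(v' x - y' x) - (v' t - y' t) =
            (v' x - v' t') - (y' x - y' t - d * (x - t)) + (y' t' - y' t - d * (t' - t)) - d * (x - t')"
          using eq by (simp add: algebra_simps)
        then have "\<bar>(v' x - y' x) - (v' t - y' t)\<bar> \<le> 3 * (\<epsilon> * \<bar>x - t\<bar>) + \<bar>d\<bar> * (\<epsilon> * \<bar>x - t\<bar>)"
          using a2 a3 a4 a5 by linarith
        also have "\<dots> = (3 + \<bar>d\<bar>) * \<epsilon> * \<bar>x - t\<bar>" by (simp add: algebra_simps)
        also have "\<dots> \<le> e * \<bar>x - t\<bar>"
          using e by (intro mult_right_mono) (auto simp: \<epsilon>_def field_simps)
        finally show ?thesis by simp
      qed
      ultimately show "\<exists>\<delta>>0. \<forall>x. \<bar>x - t\<bar> < \<delta> \<longrightarrow>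
          \<bar>(v' x - y' x) - (v' t - y' t) - 0 * (x - t)\<bar> \<le> e * \<bar>x - t\<bar>" by blast
    qed
    from DERIV_add[OF this d] show "(v' has_real_derivative d) (at t)" by simp
  qed
qed


section \<open>Green's function and its cone property\<close>

lemma absolutely_integrable_continuous_mult:
  fixes \<phi> k :: "real \<Rightarrow> real"
  assumes "continuous_on {p..q} \<phi>" "k absolutely_integrable_on {p..q}"
  shows "(\<lambda>s. \<phi> s * k s) absolutely_integrable_on {p..q}"
proof (rule absolutely_integrable_bounded_measurable_product_real)
  show "\<phi> \<in> borel_measurable (lebesgue_on {p..q})"
    using assms by (intro continuous_imp_measurable_on_sets_lebesgue) auto
  show "bounded (\<phi> ` {p..q})"
    using assms by (intro compact_imp_bounded compact_continuous_image) auto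
qed (use assms in auto)

lemmas absolutely_integrable_imp_integrable =
  absolutely_integrable_on_def[THEN iffD1, THEN conjunct1]

lemmas integrable_continuous_mult =
  absolutely_integrable_imp_integrable[OF absolutely_integrable_continuous_mult]

text \<open>The ramp is the kernel of double integration. Replacing its increment by
  \<open>t' - t\<close> times the indicator of \<open>s \<le> t\<close> is exact unless
  \<open>s\<close> lies between \<open>t\<close> and \<open>t'\<close>, so the remainder is at most
  \<open>|t' - t|\<close> times the mass of \<open>|k|\<close> there. Continuity of the primitive
  \<open>A\<close> makes this \<open>o(|t' - t|)\<close> at every \<open>t\<close>, although
  \<open>k\<close> is merely integrable.\<close>

lemma integral_ramp_has_derivative:
  fixes k :: "real \<Rightarrow> real"
  assumes k: "k absolutely_integrable_on {0..1}" and t: "t \<in> {0..1}"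
  shows "((\<lambda>t. integral {0..1} (\<lambda>s. max 0 (t - s) * k s)) has_real_derivative integral {0..t} k)
           (at t within {0..1})"
proof -
  define V where "V = (\<lambda>t. integral {0..1} (\<lambda>s. max 0 (t - s) * k s))"
  define A where "A x = integral {0..x} (\<lambda>s. \<bar>k s\<bar>)" for x
  have ki: "k integrable_on {0..1}" and ka: "(\<lambda>s. \<bar>k s\<bar>) integrable_on {0..1}"
    using k absolutely_integrable_on_def[where f = k] by auto
  have ri: "(\<lambda>s. max 0 (t - s) * k s) integrable_on {0..1}" for t
    using k by (intro integrable_continuous_mult continuous_intros)
  have contA: "continuous_on {0..1} A"
    unfolding A_def using ka by (rule indefinite_integral_continuous_1)
  have key: "\<bar>V t' - V t - integral {0..t} k * (t' - t)\<bar> \<le> \<bar>A t' - A t\<bar> * \<bar>t' - t\<bar>" if t': "t' \<in> {0..1}" for t'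
  proof -
    define J where "J = {min t t'..max t t'}"
    have J: "J \<subseteq> {0..1}" using t t' by (auto simp: J_def)
    let ?I = "\<lambda>s. if s \<in> {0..t} then k s else 0"
    let ?L = "\<lambda>s. max 0 (t' - s) * k s - max 0 (t - s) * k s - (t' - t) * ?I s"
    have t01: "{0..t} \<inter> {0..1} = {0..t}" using t by auto
    have "k integrable_on {0..t} \<inter> {0..1}"
      unfolding t01 using t by (intro integrable_on_subinterval[OF ki]) auto
    then have Ii: "?I integrable_on {0..1}" 
      by (simp only: integrable_restrict_Int)
    have "integral {0..1} ?I = integral ({0..t} \<inter> {0..1}) k"
      by (simp only: integral_restrict_Int)
    also note t01
    finally have I: "integral {0..1} ?I = integral {0..t} k" .
    have Li: "?L integrable_on {0..1}"
      by (intro integrable_diff ri integrable_on_mult_right Ii)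
    have VL: "V t' - V t - integral {0..t} k * (t' - t) = integral {0..1} ?L"
      unfolding V_def I[symmetric] mult.commute[of _ "t' - t"]
      by (simp only: Henstock_Kurzweil_Integration.integral_diff integral_mult_right integrable_diff
           integrable_on_mult_right ri Ii)
    have "\<bar>V t' - V t - integral {0..t} k * (t' - t)\<bar>
        \<le> integral {0..1} (\<lambda>s. \<bar>t' - t\<bar> * (if s \<in> J then \<bar>k s\<bar> else 0))"
      unfolding VL
    proof (rule Henstock_Kurzweil_Integration.integral_norm_bound_integral[OF Li, unfolded real_norm_def])
      have "(\<lambda>s. \<bar>k s\<bar>) integrable_on J"
        unfolding J_def using t t' by (intro integrable_on_subinterval[OF ka]) auto
      moreover have "J \<inter> {0..1} = J" using J by auto
      ultimately have "(\<lambda>s. \<bar>k s\<bar>) integrable_on J \<inter> {0..1}" by simp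
      then show "(\<lambda>s. \<bar>t' - t\<bar> * (if s \<in> J then \<bar>k s\<bar> else 0)) integrable_on {0..1}"
        by (intro integrable_on_mult_right) (simp only: integrable_restrict_Int)
      fix s :: real assume s: "s \<in> {0..1}"
      have "?L s = (max 0 (t' - s) - max 0 (t - s) - (t' - t) * (if s \<le> t then 1 else 0)) * k s"
        using s by (auto simp: algebra_simps)
      moreover have "\<bar>max 0 (t' - s) - max 0 (t - s) - (t' - t) * (if s \<le> t then 1 else 0)\<bar>
          \<le> \<bar>t' - t\<bar> * (if s \<in> J then 1 else 0)"
        by (auto simp: J_def max_def min_def)
      ultimately have "\<bar>?L s\<bar> \<le> (\<bar>t' - t\<bar> * (if s \<in> J then 1 else 0)) * \<bar>k s\<bar>"
        by (metis abs_mult abs_ge_zero mult_right_mono)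
      then show "\<bar>?L s\<bar> \<le> \<bar>t' - t\<bar> * (if s \<in> J then \<bar>k s\<bar> else 0)" by (auto split: if_splits)
    qed
    also have "\<dots> = \<bar>t' - t\<bar> * integral (J \<inter> {0..1}) (\<lambda>s. \<bar>k s\<bar>)"
      by (simp only: integral_mult_right integral_restrict_Int)
    also have "integral (J \<inter> {0..1}) (\<lambda>s. \<bar>k s\<bar>) = \<bar>A t' - A t\<bar>"
    proof -
      have "integral J (\<lambda>s. \<bar>k s\<bar>) = A (max t t') - A (min t t')"
        unfolding A_def J_def using t t' by (intro integral_diff_real[OF ka, symmetric]) auto
      moreover have "integral J (\<lambda>s. \<bar>k s\<bar>) \<ge> 0"
        unfolding J_def using t t' by (intro Henstock_Kurzweil_Integration.integral_nonneg integrable_on_subinterval[OF ka]) auto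
      moreover have "J \<inter> {0..1} = J" using J by auto
      ultimately show ?thesis by (auto simp: max_def min_def split: if_splits)
    qed
    finally show ?thesis by (simp add: mult.commute)
  qed
  have "(V has_derivative (\<lambda>h. integral {0..t} k * h)) (at t within {0..1})"
    unfolding has_derivative_within_alt
  proof (intro conjI allI impI)
    fix e :: real assume "e > 0"
    then obtain d where d: "d > 0" "\<And>y. y \<in> {0..1} \<Longrightarrow> \<bar>y - t\<bar> < d \<Longrightarrow> \<bar>A y - A t\<bar> < e"
      using contA t unfolding continuous_on_iff dist_real_def by meson
    show "\<exists>d>0. \<forall>y\<in>{0..1}. norm (y - t) < d \<longrightarrow>
        norm (V y - V t - integral {0..t} k * (y - t)) \<le> e * norm (y - t)"
    proof (intro exI[of _ d] conjI ballI impI d(1))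
      fix y :: real assume y: "y \<in> {0..1}" "norm (y - t) < d"
      have "\<bar>A y - A t\<bar> * \<bar>y - t\<bar> \<le> e * \<bar>y - t\<bar>"
        using d(2)[of y] y by (intro mult_right_mono) auto
      with key[OF y(1)] show "norm (V y - V t - integral {0..t} k * (y - t)) \<le> e * norm (y - t)" by simp
    qed
  qed (rule bounded_linear_mult_right)
  then show ?thesis unfolding has_field_derivative_def V_def .
qed

locale sturm_liouville =
  fixes alpha beta gam delta :: real
  assumes params: "alpha \<ge> 0" "beta \<ge> 0" "gam \<ge> 0" "delta \<ge> 0"
    and Gam_pos: "gam * beta + alpha * gam + alpha * delta > 0"
begin

abbreviation "Gam \<equiv> gam * beta + alpha * gam + alpha * delta"
abbreviation "G \<equiv> green alpha beta gam delta"

lemma sum_pos: "alpha + beta > 0" "gam + delta > 0"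
proof -
  show "alpha + beta > 0"
  proof (rule ccontr)
    assume "\<not> alpha + beta > 0"
    then have "alpha = 0" "beta = 0" using params by auto
    then show False using Gam_pos by simp
  qed
  show "gam + delta > 0"
  proof (rule ccontr)
    assume "\<not> gam + delta > 0"
    then have "gam = 0" "delta = 0" using params by auto
    then show False using Gam_pos by simp
  qed
qed

text \<open>The two branches of the kernel differ by exactly \<open>t - s\<close>, because the
  corresponding products differ by \<open>(t - s) * Gam\<close>. The single formula gives continuity
  at once and ties the kernel to the ramp of the initial value problem.\<close>

lemma green_eq_ramp:
  "G t s = (beta + alpha * t) * (gam + delta - gam * s) / Gam - max 0 (t - s)"
proof (cases "s \<le> t")
  case True
  have "(gam + delta - gam * t) * (beta + alpha * s) =
    (beta + alpha * t) * (gam + delta - gam * s) - (t - s) * Gam"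
    by (simp add: algebra_simps)
  then have "(gam + delta - gam * t) * (beta + alpha * s) / Gam =
    (beta + alpha * t) * (gam + delta - gam * s) / Gam - (t - s)"
    using Gam_pos by (simp add: diff_divide_distrib)
  then show ?thesis using True by (simp add: green_def Let_def)
next
  case False
  then show ?thesis by (simp add: green_def Let_def)
qed

lemma continuous_green: "continuous_on S (\<lambda>s. G t s)"
  unfolding green_eq_ramp by (intro continuous_intros) (use Gam_pos in auto)

lemma green_nonneg:
  assumes "t \<in> {0..1}" "s \<in> {0..1}"
  shows "G t s \<ge> 0"
proof -
  have *: "gam * x \<le> gam + delta" if "x \<in> {0..1}" for x
    using mult_left_mono[of x 1 gam] that params by auto
  show ?thesis
    using assms params Gam_pos * by (auto simp: green_def Let_def)
qed

lemma green_le_diagonal: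
  assumes t: "t \<in> {0..1}" and s: "s \<in> {0..1}"
  shows "G t s \<le> G s s"
proof (cases "s \<le> t")
  case True
  have "gam + delta - gam * t \<le> gam + delta - gam * s"
    using True params by (simp add: mult_left_mono)
  then have "(gam + delta - gam * t) * (beta + alpha * s) \<le> (gam + delta - gam * s) * (beta + alpha * s)"
    using params s by (intro mult_right_mono) auto
  then show ?thesis using True Gam_pos by (simp add: green_def Let_def divide_right_mono)
next
  case False
  have "gam * s \<le> gam + delta" using mult_left_mono[of s 1 gam] s params by auto
  then have "(beta + alpha * t) * (gam + delta - gam * s) \<le> (beta + alpha * s) * (gam + delta - gam * s)"
    using params False by (intro mult_right_mono) (auto simp: mult_left_mono)
  then show ?thesis using False Gam_pos by (simp add: green_def Let_def divide_right_mono mult.commute)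
qed

text \<open>For fixed \<open>k\<close> the defect is affine in the shooting parameter with slope
  \<open>Gam\<close>. Solving for \<open>x\<close> and substituting into the initial value formula
  turns the ramp into the Green kernel and leaves a multiple of the solution of the homogeneous
  equation with the left boundary condition.\<close>

lemma green_representation:
  fixes k :: "real \<Rightarrow> real"
  assumes k: "k absolutely_integrable_on {0..1}"
    and v: "\<And>t. v t = (beta + alpha * t) * x - integral {0..1} (\<lambda>s. max 0 (t - s) * k s)"
    and B: "B = gam * v 1 + delta * (alpha * x - integral {0..1} k)"
  shows "v t = integral {0..1} (\<lambda>s. G t s * k s) + B * ((beta + alpha * t) / Gam)"
proof -
  have ki: "k integrable_on {0..1}" using k by (rule absolutely_integrable_imp_integrable)
  have si: "(\<lambda>s. s * k s) integrable_on {0..1}"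
    using k by (intro integrable_continuous_mult continuous_intros)
  have ri: "(\<lambda>s. max 0 (t - s) * k s) integrable_on {0..1}"
    using k by (intro integrable_continuous_mult continuous_intros)
  define K S where "K = integral {0..1} k" and "S = integral {0..1} (\<lambda>s. s * k s)"
  have "integral {0..1} (\<lambda>s. max 0 (1 - s) * k s) = integral {0..1} (\<lambda>s. k s - s * k s)"
    by (intro integral_cong) (auto simp: algebra_simps)
  also have "\<dots> = K - S" unfolding K_def S_def using ki si by (rule Henstock_Kurzweil_Integration.integral_diff)
  finally have v1: "v 1 = (beta + alpha) * x - (K - S)" using v[of 1] by simp
  then have B': "B = Gam * x - ((gam + delta) * K - gam * S)"
    unfolding B K_def[symmetric] v1 by (simp add: algebra_simps)
  let ?c = "(beta + alpha * t) / Gam"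
  have "integral {0..1} (\<lambda>s. G t s * k s) =
     integral {0..1} (\<lambda>s. (?c * ((gam + delta) * k s) - ?c * (gam * (s * k s))) - max 0 (t - s) * k s)"
    by (intro integral_cong) (simp add: green_eq_ramp algebra_simps diff_divide_distrib add_divide_distrib)
  also have "\<dots> = ?c * ((gam + delta) * K) - ?c * (gam * S) - integral {0..1} (\<lambda>s. max 0 (t - s) * k s)"
    unfolding K_def S_def
    by (simp only: Henstock_Kurzweil_Integration.integral_diff integral_mult_right integrable_diff integrable_on_mult_right ki si ri)
  also have "\<dots> = v t - ((beta + alpha * t) * x - ?c * ((gam + delta) * K - gam * S))"
  proof -
    have "q * ((gam + delta) * K) - q * (gam * S) - I = w - I - (w - q * ((gam + delta) * K - gam * S))"
      for q w I by (simp add: algebra_simps)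
    then show ?thesis unfolding v[of t] .
  qed
  also have "(beta + alpha * t) * x - ?c * ((gam + delta) * K - gam * S) = B * ?c"
    unfolding B' using Gam_pos by (simp add: field_simps)
  finally show ?thesis by simp
qed

end

locale sturm_liouville_cone = sturm_liouville +
  fixes a b c :: real
  assumes ab: "0 \<le> a" "a < b" "b \<le> 1" "alpha = 0 \<or> - beta / alpha < a" "gam = 0 \<or> b < 1 + delta / gam"
    and c_eq: "c = min ((gam + delta - gam * b) / (gam + delta)) ((beta + alpha * a) / (alpha + beta))"
begin

text \<open>This is the content of the strict restrictions on \<open>a\<close> and \<open>b\<close>:
  multiplied out, they say that both linear factors of the kernel stay positive on
  \<open>[a,b]\<close>, which makes \<open>c\<close> positive.\<close>

lemma end_pos: "gam + delta - gam * b > 0" "beta + alpha * a > 0"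
proof -
  show "gam + delta - gam * b > 0"
    using ab(5) sum_pos params by (cases "gam = 0") (auto simp: field_simps)
  show "beta + alpha * a > 0"
    using ab(4) sum_pos params by (cases "alpha = 0") (auto simp: field_simps)
qed

lemma c_mult: "c * (gam + delta) \<le> gam + delta - gam * b" "c * (alpha + beta) \<le> beta + alpha * a"
proof -
  have "c \<le> (gam + delta - gam * b) / (gam + delta)" "c \<le> (beta + alpha * a) / (alpha + beta)"
    by (simp_all add: c_eq)
  then show "c * (gam + delta) \<le> gam + delta - gam * b" "c * (alpha + beta) \<le> beta + alpha * a"
    using sum_pos by (simp_all only: pos_le_divide_eq)
qed

lemma c_bounds: "0 < c" "c \<le> 1"
proof -
  show "0 < c" using end_pos sum_pos by (auto simp: c_eq)
  have "c * (gam + delta) \<le> 1 * (gam + delta)"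
    using c_mult(1) params ab by (smt (verit) mult_nonneg_nonneg)
  then show "c \<le> 1" using sum_pos(2) by (simp only: mult_le_cancel_right_pos)
qed

text \<open>The homogeneous solution obeys the cone inequality with the same constant as the kernel,
  so the inequality survives adding a nonnegative multiple of it.\<close>

lemma line_cone:
  assumes "t \<in> {a..b}" "r \<in> {0..1}"
  shows "c * (beta + alpha * r) \<le> beta + alpha * t"
proof -
  have "c * (beta + alpha * r) \<le> c * (alpha + beta)"
    using assms params c_bounds by (intro mult_left_mono) (auto simp: mult_left_le)
  also have "\<dots> \<le> beta + alpha * a" by (rule c_mult)
  also have "\<dots> \<le> beta + alpha * t" using assms params by (simp add: mult_left_mono)
  finally show ?thesis .
qed

text \<open>The diagonal serves as intermediary: \<open>G r s \<le> G s s\<close>, and then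
  \<open>c * G s s \<le> G t s\<close>. The two terms of the minimum defining \<open>c\<close>
  handle the cases \<open>s \<le> t\<close> and \<open>t < s\<close> respectively.\<close>

lemma green_cone:
  assumes t: "t \<in> {a..b}" and r: "r \<in> {0..1}" and s: "s \<in> {0..1}"
  shows "c * G r s \<le> G t s"
proof -
  have "c * G r s \<le> c * G s s"
    using green_le_diagonal[OF r s] c_bounds by (intro mult_left_mono) auto
  also have "\<dots> \<le> G t s"
  proof (cases "s \<le> t")
    case True
    have "c * (gam + delta - gam * s) \<le> c * (gam + delta)"
      using params s c_bounds by (intro mult_left_mono) auto
    also have "\<dots> \<le> gam + delta - gam * b" by (rule c_mult)
    also have "\<dots> \<le> gam + delta - gam * t" using t params by (simp add: mult_left_mono)
    finally have "c * (gam + delta - gam * s) * (beta + alpha * s) \<le> (gam + delta - gam * t) * (beta + alpha * s)"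
      using params s by (intro mult_right_mono) auto
    then have "c * (gam + delta - gam * s) * (beta + alpha * s) / Gam \<le> (gam + delta - gam * t) * (beta + alpha * s) / Gam"
      using Gam_pos by (intro divide_right_mono) auto
    then show ?thesis using True by (simp add: green_def Let_def)
  next
    case False
    have "gam * s \<le> gam + delta" using mult_left_mono[of s 1 gam] s params by auto
    then have "c * (beta + alpha * s) * (gam + delta - gam * s) \<le> (beta + alpha * t) * (gam + delta - gam * s)"
      using line_cone[OF t s] by (intro mult_right_mono) auto
    then have "c * (beta + alpha * s) * (gam + delta - gam * s) / Gam \<le> (beta + alpha * t) * (gam + delta - gam * s) / Gam"
      using Gam_pos by (intro divide_right_mono) auto
    then show ?thesis using False by (simp add: green_def Let_def mult.commute mult.left_commute)
  qed
  finally show ?thesis .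
qed

text \<open>Over the square each linear factor is smallest at an endpoint. The bound keeps the
  infimum defining \<open>1/M(a,b)\<close> away from zero.\<close>

lemma green_lower_bound:
  assumes t: "t \<in> {a..b}" and s: "s \<in> {a..b}"
  shows "(beta + alpha * a) * (gam + delta - gam * b) / Gam \<le> G t s"
proof -
  have *: "(beta + alpha * a) * (gam + delta - gam * b) \<le> (beta + alpha * x) * (gam + delta - gam * y)"
    if "x \<in> {a..b}" "y \<in> {a..b}" for x y
    using that params end_pos ab by (intro mult_mono) (auto simp: mult_left_mono)
  show ?thesis
    using divide_right_mono[OF *[of s t], of Gam] divide_right_mono[OF *[of t s], of Gam] t s Gam_pos
    by (auto simp: green_def Let_def mult.commute)
qed

end


section \<open>Shooting for the discretised problem\<close>

definition hat :: "nat \<Rightarrow> nat \<Rightarrow> real \<Rightarrow> real" where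
  "hat N i z = max 0 (1 - \<bar>real N * z - real i\<bar>)"

definition clip :: "nat \<Rightarrow> real \<Rightarrow> real" where
  "clip P y = max 0 (min (real P) y)"

text \<open>Division by the sum of the hats makes this a convex combination as soon as that sum is
  positive, without a proof that the hats form a partition of unity.\<close>

definition interp :: "nat \<Rightarrow> nat \<Rightarrow> (real \<Rightarrow> real) \<Rightarrow> real \<Rightarrow> real" where
  "interp N P \<phi> y = (\<Sum>i\<le>N * P. hat N i (clip P y) * \<phi> (real i / real N)) / (\<Sum>i\<le>N * P. hat N i (clip P y))"

lemma clip_bounds: "0 \<le> clip P y" "clip P y \<le> real P"
  by (auto simp: clip_def)

lemma sum_hat_pos:
  assumes "0 \<le> z" "z \<le> real P"
  shows "(\<Sum>i\<le>N * P. hat N i z) > 0"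
proof (rule sum_pos2)
  have "real N * z \<le> real N * real P" using assms by (intro mult_left_mono) auto
  then have "\<lfloor>real N * z\<rfloor> \<le> int (N * P)"
    by (metis floor_mono floor_of_nat of_nat_mult)
  then show "nat \<lfloor>real N * z\<rfloor> \<in> {..N * P}" by (auto simp: nat_le_iff)
  have "real (nat \<lfloor>real N * z\<rfloor>) = of_int \<lfloor>real N * z\<rfloor>" using assms by simp
  then show "hat N (nat \<lfloor>real N * z\<rfloor>) z > 0"
    unfolding hat_def by (simp add: less_max_iff_disj) linarith
qed (auto simp: hat_def)

text \<open>Only nodes within \<open>1/N\<close> of the clipped point carry positive weight, and a
  convex combination of values above \<open>lo\<close> stays above \<open>lo\<close>.\<close>

lemma interp_ge:
  assumes N: "N > 0"
    and \<phi>: "\<And>y. 0 \<le> y \<Longrightarrow> y \<le> real P \<Longrightarrow> \<bar>y - clip P u\<bar> \<le> 1 / real N \<Longrightarrow> lo \<le> \<phi> y"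
  shows "lo \<le> interp N P \<phi> u"
proof -
  let ?S = "\<Sum>i\<le>N * P. hat N i (clip P u)"
  have S: "?S > 0" by (intro sum_hat_pos clip_bounds)
  have "lo * hat N i (clip P u) \<le> hat N i (clip P u) * \<phi> (real i / real N)" if i: "i \<le> N * P" for i
  proof (cases "hat N i (clip P u) = 0")
    case False
    then have h: "hat N i (clip P u) > 0" "\<bar>real N * clip P u - real i\<bar> < 1"
      by (auto simp: hat_def max_def split: if_splits)
    have "real i / real N - clip P u = (real i - real N * clip P u) / real N"
      using N by (simp add: field_simps)
    then have "\<bar>real i / real N - clip P u\<bar> = \<bar>real N * clip P u - real i\<bar> / real N"
      by (simp add: abs_minus_commute)
    also have "\<dots> \<le> 1 / real N" using h by (intro divide_right_mono) auto
    finally have 1: "\<bar>real i / real N - clip P u\<bar> \<le> 1 / real N" .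
    have "real i \<le> real N * real P" using i by (metis of_nat_le_iff of_nat_mult)
    then have "real i / real N \<le> real P" using N by (simp add: field_simps)
    then have "lo \<le> \<phi> (real i / real N)"
      using 1 by (intro \<phi>) auto
    then show ?thesis using h by (auto simp: mult.commute)
  qed auto
  then have "lo * ?S \<le> (\<Sum>i\<le>N * P. hat N i (clip P u) * \<phi> (real i / real N))"
    unfolding sum_distrib_left by (intro sum_mono) auto
  then show ?thesis using S by (simp add: interp_def pos_le_divide_eq)
qed

lemma interp_le:
  assumes N: "N > 0"
    and \<phi>: "\<And>y. 0 \<le> y \<Longrightarrow> y \<le> real P \<Longrightarrow> \<bar>y - clip P u\<bar> \<le> 1 / real N \<Longrightarrow> \<phi> y \<le> hi"
  shows "interp N P \<phi> u \<le> hi"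
proof -
  have "- hi \<le> interp N P (\<lambda>y. - \<phi> y) u"
    using \<phi> by (intro interp_ge[OF N]) auto
  then show ?thesis by (simp add: interp_def sum_negf)
qed

lemma continuous_on_interp: "continuous_on A (interp N P \<phi>)"
proof -
  have "(\<Sum>i\<le>N * P. hat N i (clip P y)) \<noteq> 0" for y
    using sum_hat_pos[OF clip_bounds] by (metis less_irrefl)
  then show ?thesis
    unfolding interp_def by (intro continuous_intros) (auto simp: hat_def clip_def intro!: continuous_intros)
qed

lemma continuous_on_Max_image:
  fixes F :: "'a::topological_space \<Rightarrow> nat \<Rightarrow> real"
  assumes "\<And>j. j \<le> n \<Longrightarrow> continuous_on A (\<lambda>x. F x j)"
  shows "continuous_on A (\<lambda>x. Max (F x ` {..n}))"
  using assms
proof (induction n)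
  case 0
  then show ?case by simp
next
  case (Suc n)
  have "Max (F x ` {..Suc n}) = max (F x (Suc n)) (Max (F x ` {..n}))" for x
    by (simp add: atMost_Suc)
  then show ?case using Suc by (auto intro!: continuous_intros)
qed

text \<open>Take \<open>x2\<close> as the first parameter with value \<open>q\<close> and
  \<open>x1\<close> as the last one before it with value \<open>p\<close>. Leaving
  \<open>[p,q]\<close> in between would produce an earlier \<open>q\<close> or a later
  \<open>p\<close>.\<close>

lemma crossing_interval:
  fixes \<mu> :: "real \<Rightarrow> real"
  assumes cont: "continuous_on {0..X} \<mu>" and X: "0 \<le> X" and \<mu>: "\<mu> 0 \<le> p" "p < q" "q \<le> \<mu> X"
  obtains x1 x2 where "0 \<le> x1" "x1 \<le> x2" "x2 \<le> X" "\<mu> x1 = p" "\<mu> x2 = q"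
    "\<forall>x\<in>{x1..x2}. p \<le> \<mu> x \<and> \<mu> x \<le> q"
proof -
  define A where "A = {x\<in>{0..X}. \<mu> x = q}"
  have "closed A" unfolding A_def by (intro continuous_closed_preimage_constant cont closed_real_atLeastAtMost)
  moreover have "A \<subseteq> {0..X}" by (auto simp: A_def)
  ultimately have "compact A" by (meson bounded_closed_interval bounded_subset compact_eq_bounded_closed)
  moreover have "A \<noteq> {}"
    using IVT'[of \<mu> 0 q X] \<mu> X cont by (auto simp: A_def)
  ultimately obtain x2 where x2: "x2 \<in> A" "\<And>x. x \<in> A \<Longrightarrow> x2 \<le> x"
    using compact_attains_inf by metis
  have x2': "0 \<le> x2" "x2 \<le> X" "\<mu> x2 = q" using x2 by (auto simp: A_def)
  have sub: "{0..x2} \<subseteq> {0..X}" using x2' by auto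
  have cont2: "continuous_on {0..x2} \<mu>" by (rule continuous_on_subset[OF cont sub])
  have below: "\<mu> x \<le> q" if x: "0 \<le> x" "x \<le> x2" for x
  proof (rule ccontr)
    assume "\<not> \<mu> x \<le> q"
    moreover have "continuous_on {0..x} \<mu>" by (rule continuous_on_subset[OF cont2]) (use x in auto)
    ultimately obtain z where "0 \<le> z" "z \<le> x" "\<mu> z = q"
      using IVT'[of \<mu> 0 q x] \<mu> x by auto
    then have "z \<in> A" using x x2' by (auto simp: A_def)
    then have "x = x2" using x2(2)[of z] \<open>z \<le> x\<close> x by auto
    then show False using \<open>\<not> \<mu> x \<le> q\<close> x2' by simp
  qed
  define B where "B = {x\<in>{0..x2}. \<mu> x = p}"
  have "closed B" unfolding B_def by (intro continuous_closed_preimage_constant cont2 closed_real_atLeastAtMost)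
  moreover have "B \<subseteq> {0..x2}" by (auto simp: B_def)
  ultimately have "compact B" by (meson bounded_closed_interval bounded_subset compact_eq_bounded_closed)
  moreover have "B \<noteq> {}"
    using IVT'[of \<mu> 0 p x2] \<mu> x2' cont2 by (auto simp: B_def)
  ultimately obtain x1 where x1: "x1 \<in> B" "\<And>x. x \<in> B \<Longrightarrow> x \<le> x1"
    using compact_attains_sup by metis
  have x1': "0 \<le> x1" "x1 \<le> x2" "\<mu> x1 = p" using x1 by (auto simp: B_def)
  have above: "p \<le> \<mu> x" if x: "x1 \<le> x" "x \<le> x2" for x
  proof (rule ccontr)
    assume "\<not> p \<le> \<mu> x"
    moreover have "continuous_on {x..x2} \<mu>" by (rule continuous_on_subset[OF cont2]) (use x x1' in auto)
    ultimately obtain z where "x \<le> z" "z \<le> x2" "\<mu> z = p"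
      using IVT'[of \<mu> x p x2] \<mu> x x1' x2' by auto
    then have "z \<in> B" using x x1' by (auto simp: B_def)
    then have "x = x1" using x1(2)[of z] \<open>x \<le> z\<close> x by auto
    then show False using \<open>\<not> p \<le> \<mu> x\<close> x1' by simp
  qed
  show thesis
    using that[of x1 x2] x1' x2' below above by auto
qed

text \<open>\<open>gf_le\<close> bounds the product and not \<open>f\<close>: it then holds at every
  \<open>t\<close> once \<open>g\<close> is set to 0 on the null set where the bound
  \<open>R\<close> for \<open>f\<close> may fail.\<close>

locale shooting = sturm_liouville +
  fixes f :: "real \<Rightarrow> real \<Rightarrow> real" and g :: "real \<Rightarrow> real" and R :: real and P N :: nat
  assumes f_nonneg: "\<And>t u. t \<in> {0..1} \<Longrightarrow> 0 \<le> u \<Longrightarrow> 0 \<le> f t u"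
    and f_meas: "\<And>u. 0 \<le> u \<Longrightarrow> (\<lambda>t. f t u) \<in> borel_measurable (lebesgue_on {0..1})"
    and g_int: "g absolutely_integrable_on {0..1}"
    and g_nonneg: "\<And>t. t \<in> {0..1} \<Longrightarrow> 0 \<le> g t"
    and gf_le: "\<And>t u. t \<in> {0..1} \<Longrightarrow> 0 \<le> u \<Longrightarrow> u \<le> real P \<Longrightarrow> g t * f t u \<le> R * g t"
    and R_nonneg: "0 \<le> R"
    and N_pos: "0 < N"
begin

definition cell :: "real \<Rightarrow> nat" where "cell s = nat \<lfloor>real N * s\<rfloor>"

definition k :: "(nat \<Rightarrow> real) \<Rightarrow> real \<Rightarrow> real" where
  "k y s = g s * interp N P (f s) (y (cell s))"

lemma cell:
  assumes "0 \<le> s"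
  shows "real (cell s) / N \<le> s" "s < real (cell s) / N + 1 / N"
proof -
  have "real (cell s) = of_int \<lfloor>real N * s\<rfloor>" using assms by (simp add: cell_def)
  then have "real (cell s) \<le> real N * s" "real N * s < real (cell s) + 1" by linarith+
  then show "real (cell s) / N \<le> s" "s < real (cell s) / N + 1 / N"
    using N_pos by (auto simp: field_simps)
qed

lemma cell_le:
  assumes "s \<in> {0..1}"
  shows "cell s \<le> N"
proof -
  have "real (cell s) / N \<le> 1" using cell(1)[of s] assms by auto
  then have "real (cell s) \<le> real N" using N_pos by (simp add: field_simps)
  then show ?thesis by simp
qed

lemma interp_nonneg: "s \<in> {0..1} \<Longrightarrow> 0 \<le> interp N P (f s) u"
  unfolding interp_def by (intro divide_nonneg_nonneg sum_nonneg mult_nonneg_nonneg) (auto simp: hat_def f_nonneg)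

lemma k_bounds:
  assumes s: "s \<in> {0..1}"
  shows "0 \<le> k y s" "k y s \<le> R * g s"
proof -
  show "0 \<le> k y s" using g_nonneg[OF s] interp_nonneg[OF s] by (simp add: k_def)
  show "k y s \<le> R * g s"
  proof (cases "g s = 0")
    case False
    then have gs: "g s > 0" using g_nonneg[OF s] by simp
    have "interp N P (f s) (y (cell s)) \<le> R"
    proof (rule interp_le[OF N_pos])
      fix u assume u: "0 \<le> u" "u \<le> real P"
      show "f s u \<le> R"
        using gf_le[OF s u] gs by (simp add: mult.commute)
    qed
    then show ?thesis using gs by (simp add: k_def mult.commute)
  qed (simp add: k_def)
qed

text \<open>For measurability, \<open>f\<close> is evaluated only at finitely many fixed nodes, and
  the weights depend on \<open>s\<close> through the integer-valued cell index alone. The domination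
  is by \<open>R * g\<close>.\<close>

lemma k_int: "k y absolutely_integrable_on {0..1}"
proof (rule measurable_bounded_by_integrable_imp_absolutely_integrable)
  have lin: "(\<lambda>s. real N * s) \<in> borel_measurable (lebesgue_on {0..1})"
    by (intro continuous_imp_measurable_on_sets_lebesgue continuous_intros) auto
  have "(\<lambda>s. nat \<lfloor>real N * s\<rfloor>) \<in> measurable (lebesgue_on {0..1}) (count_space UNIV)"
    using measurable_compose[OF measurable_compose[OF lin measurable_real_floor], of nat "count_space UNIV"] by simp
  then have hat: "(\<lambda>s. hat N i (clip P (y (cell s)))) \<in> borel_measurable (lebesgue_on {0..1})" for i
    unfolding cell_def by (rule measurable_compose) simp
  have "g \<in> borel_measurable (lebesgue_on {0..1})"
    using g_int by (subst (asm) absolutely_integrable_measurable) auto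
  then show "k y \<in> borel_measurable (lebesgue_on {0..1})"
    unfolding k_def[abs_def] interp_def
    by (intro borel_measurable_times borel_measurable_divide borel_measurable_sum hat f_meas) auto
  show "(\<lambda>s. R * g s) integrable_on {0..1}"
    using absolutely_integrable_imp_integrable[OF g_int] by (rule integrable_on_mult_right)
  show "norm (k y x) \<le> R * g x" if "x \<in> {0..1}" for x
    using k_bounds[OF that] by simp
qed simp

lemmas k_integrable = absolutely_integrable_imp_integrable[OF k_int]
lemmas g_integrable = absolutely_integrable_imp_integrable[OF g_int]

lemma phi_k_integrable: "continuous_on {0..1} \<phi> \<Longrightarrow> (\<lambda>s. \<phi> s * k y s) integrable_on {0..1}"
  by (intro integrable_continuous_mult k_int)

lemma phi_g_integrable: "continuous_on {0..1} \<phi> \<Longrightarrow> (\<lambda>s. \<phi> s * g s) integrable_on {0..1}"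
  by (intro integrable_continuous_mult g_int)

definition grid_map :: "real \<Rightarrow> (nat \<Rightarrow> real) \<Rightarrow> nat \<Rightarrow> real" where
  "grid_map x y j = (beta + alpha * (real j / N)) * x - integral {0..1} (\<lambda>s. max 0 (real j / N - s) * k y s)"

text \<open>The ramp at node \<open>j\<close> vanishes for \<open>s \<ge> j/N\<close>, so only
  states of strictly earlier cells enter. This causality is what makes the recursion finite.\<close>

lemma grid_map_local:
  assumes "\<And>i. i < j \<Longrightarrow> y i = z i"
  shows "grid_map x y j = grid_map x z j"
proof -
  have "max 0 (real j / N - s) * k y s = max 0 (real j / N - s) * k z s" if "s \<in> {0..1}" for s
  proof (cases "s < real j / N")
    case True
    then have "real (cell s) / N < real j / N" using cell(1)[of s] that by auto
    then have "cell s < j" using N_pos by (simp add: divide_less_cancel)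
    then show ?thesis by (simp add: k_def assms)
  qed (simp add: max_def)
  then show ?thesis
    unfolding grid_map_def by (intro arg_cong2[where f = "(-)"] refl integral_cong)
qed

definition iter :: "real \<Rightarrow> nat \<Rightarrow> nat \<Rightarrow> real" where
  "iter x m = (grid_map x ^^ m) (\<lambda>_. 0)"

text \<open>By causality each application of \<open>grid_map\<close> makes one further node value
  final.\<close>

lemma iter_stable:
  assumes "j < m" "m \<le> m'"
  shows "iter x m' j = iter x m j"
  using assms
proof (induction m arbitrary: m' j)
  case (Suc m)
  then obtain m'' where m'': "m' = Suc m''" by (cases m') auto
  have "grid_map x (iter x m'') j = grid_map x (iter x m) j"
    using Suc.prems m'' by (intro grid_map_local Suc.IH) auto
  then show ?case by (simp add: m'' iter_def)
qed simp

text \<open>\<open>Suc N\<close> rounds finalise the nodes \<open>0\<close> to \<open>N\<close>. The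
  last one counts, since \<open>cell 1 = N\<close>.\<close>

definition Y :: "real \<Rightarrow> nat \<Rightarrow> real" where "Y x = iter x (Suc N)"

definition v :: "real \<Rightarrow> real \<Rightarrow> real" where
  "v x t = (beta + alpha * t) * x - integral {0..1} (\<lambda>s. max 0 (t - s) * k (Y x) s)"

text \<open>The bracket after \<open>delta\<close> is the slope of \<open>v x\<close> at 1.\<close>

definition B :: "real \<Rightarrow> real" where
  "B x = gam * v x 1 + delta * (alpha * x - integral {0..1} (k (Y x)))"

text \<open>A maximum over the nodes only: as a finite maximum it inherits continuity in
  \<open>x\<close>, and all states entering \<open>k\<close> are bounded by it.\<close>

definition mu :: "real \<Rightarrow> real" where "mu x = Max (Y x ` {..N})"

lemma Y_eq_v: "j \<le> N \<Longrightarrow> Y x j = v x (real j / N)"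
  using iter_stable[of j "Suc N" "Suc (Suc N)" x] by (simp add: Y_def v_def grid_map_def iter_def)

text \<open>The interpolant is continuous in the state even where \<open>f\<close> is not, so the
  integrands converge pointwise; domination by \<open>R * g\<close> does the rest.\<close>

lemma continuous_integral_k:
  fixes y :: "real \<Rightarrow> nat \<Rightarrow> real"
  assumes y: "\<And>i. continuous_on UNIV (\<lambda>x. y x i)" and \<phi>: "continuous_on {0..1} \<phi>"
  shows "continuous_on UNIV (\<lambda>x. integral {0..1} (\<lambda>s. \<phi> s * k (y x) s))"
proof (rule continuous_on_sequentiallyI)
  fix u a assume u: "u \<longlonglongrightarrow> (a::real)"
  show "(\<lambda>n. integral {0..1} (\<lambda>s. \<phi> s * k (y (u n)) s)) \<longlonglongrightarrow> integral {0..1} (\<lambda>s. \<phi> s * k (y a) s)"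
  proof (rule dominated_convergence(2)[where h = "\<lambda>s. \<bar>\<phi> s\<bar> * (R * g s)"])
    show "(\<lambda>s. \<phi> s * k (y (u n)) s) integrable_on {0..1}" for n
      by (rule phi_k_integrable[OF \<phi>])
    have "(\<lambda>s. R * (\<bar>\<phi> s\<bar> * g s)) integrable_on {0..1}"
      by (intro integrable_on_mult_right phi_g_integrable continuous_intros \<phi>)
    then show "(\<lambda>s. \<bar>\<phi> s\<bar> * (R * g s)) integrable_on {0..1}" by (simp add: mult.left_commute)
    fix s :: real assume s: "s \<in> {0..1}"
    show "norm (\<phi> s * k (y (u n)) s) \<le> \<bar>\<phi> s\<bar> * (R * g s)" for n
      using k_bounds[OF s] by (auto simp: abs_mult intro!: mult_left_mono)
    have "(\<lambda>n. y (u n) (cell s)) \<longlonglongrightarrow> y a (cell s)"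
      by (rule continuous_on_tendsto_compose[OF y u]) auto
    then have "(\<lambda>n. interp N P (f s) (y (u n) (cell s))) \<longlonglongrightarrow> interp N P (f s) (y a (cell s))"
      by (rule continuous_on_tendsto_compose[OF continuous_on_interp[of UNIV]]) auto
    then show "(\<lambda>n. \<phi> s * k (y (u n)) s) \<longlonglongrightarrow> \<phi> s * k (y a) s"
      unfolding k_def by (intro tendsto_intros)
  qed
qed

lemma continuous_Y: "continuous_on UNIV (\<lambda>x. Y x j)"
proof -
  have "continuous_on UNIV (\<lambda>x. iter x m j)" for m j
  proof (induction m arbitrary: j)
    case (Suc m)
    have "iter x (Suc m) = grid_map x (iter x m)" for x by (simp add: iter_def)
    moreover have "continuous_on UNIV (\<lambda>x. integral {0..1} (\<lambda>s. max 0 (real j / N - s) * k (iter x m) s))"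
      using Suc by (intro continuous_integral_k continuous_intros)
    ultimately show ?case unfolding grid_map_def by (auto intro!: continuous_intros)
  qed (simp add: iter_def)
  then show ?thesis by (simp add: Y_def)
qed

lemma continuous_B: "continuous_on UNIV B"
proof -
  have "continuous_on UNIV (\<lambda>x. integral {0..1} (\<lambda>s. 1 * k (Y x) s))"
    by (intro continuous_integral_k continuous_Y continuous_intros)
  moreover have "continuous_on UNIV (\<lambda>x. integral {0..1} (\<lambda>s. max 0 (1 - s) * k (Y x) s))"
    by (intro continuous_integral_k continuous_Y continuous_intros)
  ultimately show ?thesis
    unfolding B_def[abs_def] v_def by (auto intro!: continuous_intros)
qed

lemma continuous_mu: "continuous_on UNIV mu"
  unfolding mu_def[abs_def] by (intro continuous_on_Max_image continuous_Y)

lemma mu_attained: obtains j where "j \<le> N" "Y x j = mu x"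
proof -
  have "mu x \<in> Y x ` {..N}" unfolding mu_def by (rule Max_in) auto
  then show thesis using that by auto
qed

lemma Y_le_mu: "j \<le> N \<Longrightarrow> Y x j \<le> mu x"
  unfolding mu_def by (intro Max_ge) auto

lemma integral_k_le: "integral {0..1} (k y) \<le> R * integral {0..1} g"
proof -
  have "integral {0..1} (k y) \<le> integral {0..1} (\<lambda>s. R * g s)"
    using k_bounds by (intro integral_le k_integrable integrable_on_mult_right g_integrable)
  then show ?thesis by simp
qed

text \<open>The ramp is 1-Lipschitz in \<open>t\<close>. The constant does not involve
  \<open>N\<close>, hence freezing over a cell costs only order \<open>1/N\<close>.\<close>

lemma v_lipschitz:
  assumes "0 \<le> x"
  shows "\<bar>v x t' - v x t\<bar> \<le> (alpha * x + R * integral {0..1} g) * \<bar>t' - t\<bar>"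
proof -
  have r: "(\<lambda>s. max 0 (t - s) * k (Y x) s) integrable_on {0..1}" for t
    by (intro phi_k_integrable continuous_intros)
  let ?I = "\<lambda>t. integral {0..1} (\<lambda>s. max 0 (t - s) * k (Y x) s)"
  have "?I t' - ?I t = integral {0..1} (\<lambda>s. max 0 (t' - s) * k (Y x) s - max 0 (t - s) * k (Y x) s)"
    by (rule Henstock_Kurzweil_Integration.integral_diff[OF r r, symmetric])
  then have "\<bar>?I t' - ?I t\<bar> = norm (integral {0..1} (\<lambda>s. max 0 (t' - s) * k (Y x) s - max 0 (t - s) * k (Y x) s))"
    by simp
  also have "\<dots> \<le> integral {0..1} (\<lambda>s. \<bar>t' - t\<bar> * k (Y x) s)"
  proof (rule Henstock_Kurzweil_Integration.integral_norm_bound_integral)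
    fix s :: real assume "s \<in> {0..1}"
    then have "\<bar>max 0 (t' - s) - max 0 (t - s)\<bar> * \<bar>k (Y x) s\<bar> \<le> \<bar>t' - t\<bar> * k (Y x) s"
      using k_bounds[of s] by (intro mult_mono) auto
    then show "norm (max 0 (t' - s) * k (Y x) s - max 0 (t - s) * k (Y x) s) \<le> \<bar>t' - t\<bar> * k (Y x) s"
      by (simp add: abs_mult[symmetric] left_diff_distrib)
  qed (intro integrable_diff r integrable_on_mult_right k_integrable)+
  also have "\<dots> \<le> \<bar>t' - t\<bar> * (R * integral {0..1} g)"
    using integral_k_le by (simp add: mult_left_mono)
  finally have I: "\<bar>?I t' - ?I t\<bar> \<le> \<bar>t' - t\<bar> * (R * integral {0..1} g)" .
  have "v x t' - v x t = alpha * x * (t' - t) - (?I t' - ?I t)"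
    by (simp add: v_def algebra_simps)
  then have "\<bar>v x t' - v x t\<bar> \<le> \<bar>alpha * x * (t' - t)\<bar> + \<bar>?I t' - ?I t\<bar>" by linarith
  also have "\<bar>alpha * x * (t' - t)\<bar> = alpha * x * \<bar>t' - t\<bar>"
    using assms params by (simp add: abs_mult)
  finally show ?thesis using I by (simp add: algebra_simps)
qed

lemma v_green: "v x t = integral {0..1} (\<lambda>s. G t s * k (Y x) s) + B x * ((beta + alpha * t) / Gam)"
  by (rule green_representation[OF k_int v_def B_def])

lemma mu_zero: "mu 0 \<le> 0"
proof -
  obtain j where j: "j \<le> N" "Y 0 j = mu 0" by (rule mu_attained)
  have "0 \<le> integral {0..1} (\<lambda>s. max 0 (real j / N - s) * k (Y 0) s)"
    by (intro Henstock_Kurzweil_Integration.integral_nonneg phi_k_integrable continuous_intros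
       mult_nonneg_nonneg k_bounds) auto
  then show ?thesis using Y_eq_v[OF j(1), of 0] j by (simp add: v_def)
qed

text \<open>The forcing can lower the value at the right end by at most \<open>R\<close> times the
  integral of \<open>g\<close>, while the linear part there is \<open>(alpha + beta) * x\<close>.
  Hence the maximum passes every level, and a bound on it bounds \<open>x\<close>.\<close>

lemma mu_growth: "(alpha + beta) * x - R * integral {0..1} g \<le> mu x"
proof -
  have "integral {0..1} (\<lambda>s. max 0 (1 - s) * k (Y x) s) \<le> integral {0..1} (k (Y x))"
    using k_bounds by (intro integral_le phi_k_integrable continuous_intros k_integrable) (auto intro!: mult_left_le_one_le)
  also have "\<dots> \<le> R * integral {0..1} g" by (rule integral_k_le)
  finally have "(alpha + beta) * x - R * integral {0..1} g \<le> v x 1" by (simp add: v_def algebra_simps)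
  also have "\<dots> = Y x N" using Y_eq_v[of N x] N_pos by simp
  also have "\<dots> \<le> mu x" by (rule Y_le_mu) simp
  finally show ?thesis .
qed

lemma exists_root:
  assumes \<rho>: "0 < \<rho>1" "\<rho>1 < \<rho>2"
    and signs: "(\<forall>x\<ge>0. mu x = \<rho>1 \<longrightarrow> B x < 0) \<and> (\<forall>x\<ge>0. mu x = \<rho>2 \<longrightarrow> 0 < B x) \<or>
                (\<forall>x\<ge>0. mu x = \<rho>1 \<longrightarrow> 0 < B x) \<and> (\<forall>x\<ge>0. mu x = \<rho>2 \<longrightarrow> B x < 0)"
  obtains x where "0 \<le> x" "\<rho>1 \<le> mu x" "mu x \<le> \<rho>2" "B x = 0"
proof -
  \<comment> \<open>The parameter at which the lower bound of \<open>mu_growth\<close> equals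
    \<open>\<rho>2\<close>.\<close>
  define X where "X = (\<rho>2 + R * integral {0..1} g) / (alpha + beta)"
  have "0 \<le> integral {0..1} g"
    using g_nonneg g_integrable by (intro Henstock_Kurzweil_Integration.integral_nonneg)
  then have X: "0 \<le> X" using \<rho> sum_pos(1) R_nonneg by (auto simp: X_def)
  have mX: "\<rho>2 \<le> mu X" using mu_growth[of X] sum_pos(1) by (simp add: X_def)
  have m0: "mu 0 \<le> \<rho>1" using mu_zero \<rho> by linarith
  obtain x1 x2 where x: "0 \<le> x1" "x1 \<le> x2" "x2 \<le> X" "mu x1 = \<rho>1" "mu x2 = \<rho>2"
    "\<forall>x\<in>{x1..x2}. \<rho>1 \<le> mu x \<and> mu x \<le> \<rho>2"
    by (rule crossing_interval[OF continuous_on_subset[OF continuous_mu subset_UNIV] X m0 \<rho>(2) mX])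
  have c: "continuous_on {x1..x2} B" using continuous_on_subset[OF continuous_B] by blast
  have "\<exists>x. x1 \<le> x \<and> x \<le> x2 \<and> B x = 0"
    using signs
  proof (elim disjE conjE)
    assume "\<forall>x\<ge>0. mu x = \<rho>1 \<longrightarrow> B x < 0" "\<forall>x\<ge>0. mu x = \<rho>2 \<longrightarrow> 0 < B x"
    then have "B x1 < 0" "0 < B x2" using x by auto
    then show ?thesis using IVT'[of B x1 0 x2] x c by auto
  next
    assume "\<forall>x\<ge>0. mu x = \<rho>1 \<longrightarrow> 0 < B x" "\<forall>x\<ge>0. mu x = \<rho>2 \<longrightarrow> B x < 0"
    then have "0 < B x1" "B x2 < 0" using x by auto
    then show ?thesis using IVT2'[of B x2 0 x1] x c by auto
  qed
  then obtain z where z: "x1 \<le> z" "z \<le> x2" "B z = 0" by blast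
  then show thesis using that[of z] x(1) x(6) by auto
qed

end

section \<open>Signs of the boundary defect\<close>

context shooting
begin

lemma green_k_integrable: "(\<lambda>s. G t s * k y s) integrable_on {0..1}"
  by (intro phi_k_integrable continuous_green)

lemma green_g_integrable: "(\<lambda>s. G t s * g s) integrable_on {0..1}"
  by (intro phi_g_integrable continuous_green)

text \<open>If \<open>B x \<le> 0\<close>, the representation at a node where the maximum is
  attained gives \<open>\<rho> \<le> \<theta> * \<rho> * \<sigma> < \<rho>\<close>.\<close>

lemma B_pos:
  assumes \<rho>: "0 < \<rho>" "mu x = \<rho>" and \<theta>: "0 \<le> \<theta>" "\<theta> * \<sigma> < 1"
    and fle: "\<And>s y. s \<in> {0..1} \<Longrightarrow> 0 \<le> y \<Longrightarrow> y \<le> \<rho> + 1 / N \<Longrightarrow> f s y \<le> \<theta> * \<rho>"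
    and Gle: "\<And>t. t \<in> {0..1} \<Longrightarrow> integral {0..1} (\<lambda>s. G t s * g s) \<le> \<sigma>"
  shows "0 < B x"
proof (rule ccontr)
  assume "\<not> 0 < B x"
  then have B0: "B x \<le> 0" by simp
  obtain j where j: "j \<le> N" "Y x j = \<rho>" using mu_attained \<rho>(2) by metis
  define t where "t = real j / N"
  have t: "t \<in> {0..1}" using j N_pos by (auto simp: t_def)
  have kle: "k (Y x) s \<le> \<theta> * \<rho> * g s" if s: "s \<in> {0..1}" for s
  proof -
    \<comment> \<open>With \<open>B x \<le> 0\<close> the solution may be negative. Clipping sends
      such states to 0, which is still below \<rho>, so no sign information is required.\<close>
    have "clip P (Y x (cell s)) \<le> \<rho>"
      using Y_le_mu[OF cell_le[OF s], of x] \<rho> by (auto simp: clip_def)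
    then have "interp N P (f s) (Y x (cell s)) \<le> \<theta> * \<rho>"
      using fle[OF s] by (intro interp_le[OF N_pos]) auto
    then show ?thesis using g_nonneg[OF s] by (simp add: k_def mult.commute mult_left_mono)
  qed
  have "\<rho> = v x t" using Y_eq_v[OF j(1), of x] j by (simp add: t_def)
  also have "\<dots> \<le> integral {0..1} (\<lambda>s. G t s * k (Y x) s)"
  proof -
    have "B x * ((beta + alpha * t) / Gam) \<le> 0"
      using B0 params t Gam_pos by (intro mult_nonpos_nonneg) auto
    then show ?thesis using v_green[of x t] by linarith
  qed
  also have "\<dots> \<le> integral {0..1} (\<lambda>s. \<theta> * \<rho> * (G t s * g s))"
  proof (rule integral_le[OF green_k_integrable integrable_on_mult_right[OF green_g_integrable]])
    fix s :: real assume s: "s \<in> {0..1}"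
    show "G t s * k (Y x) s \<le> \<theta> * \<rho> * (G t s * g s)"
      using mult_left_mono[OF kle[OF s] green_nonneg[OF t s]] by (simp add: mult.left_commute mult.assoc)
  qed
  also have "\<dots> \<le> \<theta> * \<rho> * \<sigma>"
    using Gle[OF t] \<theta> \<rho> by (simp add: mult_left_mono)
  also have "\<dots> = \<rho> * (\<theta> * \<sigma>)" by simp
  also have "\<dots> < \<rho> * 1" using \<theta> \<rho> by (intro mult_strict_left_mono) auto
  finally show False by simp
qed

lemma v_nonneg:
  assumes "0 \<le> B x" "t \<in> {0..1}"
  shows "0 \<le> v x t"
proof -
  have "0 \<le> integral {0..1} (\<lambda>s. G t s * k (Y x) s)"
    using assms by (intro Henstock_Kurzweil_Integration.integral_nonneg green_k_integrable
        mult_nonneg_nonneg green_nonneg k_bounds)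
  then show ?thesis using v_green[of x t] assms params Gam_pos by auto
qed

lemma clip_Y:
  assumes "0 \<le> B x" "mu x \<le> real P" "j \<le> N"
  shows "clip P (Y x j) = v x (real j / N)"
proof -
  have "0 \<le> v x (real j / N)" using assms N_pos by (intro v_nonneg) auto
  moreover have "v x (real j / N) \<le> real P" using Y_le_mu[OF assms(3), of x] Y_eq_v[OF assms(3), of x] assms by auto
  ultimately show ?thesis using Y_eq_v[OF assms(3), of x] by (auto simp: clip_def)
qed

text \<open>Nonnegativity from \<open>B x \<ge> 0\<close> and the bound by \<open>P\<close> make
  clipping inactive. What remains is the Lipschitz error over one cell.\<close>

lemma clip_Y_near:
  assumes "0 \<le> x" "0 \<le> B x" "mu x \<le> real P" "s \<in> {0..1}" "alpha * x + R * integral {0..1} g \<le> L"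
  shows "\<bar>clip P (Y x (cell s)) - v x s\<bar> \<le> L / N"
proof -
  have "\<bar>v x (real (cell s) / N) - v x s\<bar> \<le> (alpha * x + R * integral {0..1} g) * \<bar>real (cell s) / N - s\<bar>"
    by (rule v_lipschitz[OF assms(1)])
  also have "\<dots> \<le> L * (1 / N)"
  proof (rule mult_mono)
    show "\<bar>real (cell s) / N - s\<bar> \<le> 1 / N" using cell[of s] assms(4) by auto
    have "0 \<le> integral {0..1} g"
      using g_nonneg g_integrable by (intro Henstock_Kurzweil_Integration.integral_nonneg)
    then show "0 \<le> L" using assms params R_nonneg by (smt (verit) mult_nonneg_nonneg)
  qed (use assms in auto)
  finally show ?thesis using clip_Y[OF assms(2,3) cell_le[OF assms(4)]] by simp
qed

lemma shooting_bound:
  assumes "mu x \<le> \<rho>"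
  shows "x \<le> (\<rho> + R * integral {0..1} g) / (alpha + beta)"
  using mu_growth[of x] assms sum_pos(1) by (simp add: pos_le_divide_eq mult.commute)

end

locale shooting_cone = shooting + sturm_liouville_cone
begin

text \<open>If \<open>B x \<ge> 0\<close>, the solution lies in the cone, so on \<open>[a,b]\<close>
  it is at least \<open>c * \<rho>\<close> and the lower bound on \<open>f\<close> applies there.
  The Green integral over \<open>[a,b]\<close> then exceeds \<rho>, the maximum over the
  nodes.\<close>

lemma B_neg:
  assumes \<rho>: "0 < \<rho>" "mu x = \<rho>" "\<rho> \<le> real P" and x: "0 \<le> x" and \<theta>: "0 \<le> \<theta>" "1 < \<theta> * \<tau>"
    and L: "alpha * x + R * integral {0..1} g \<le> L"
    and N: "(L + 1) / N \<le> c * \<epsilon>" "1 / N \<le> \<epsilon>" "1 / N \<le> b - a"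
    and fge: "\<And>s y. s \<in> {a..b} \<Longrightarrow> 0 \<le> y \<Longrightarrow> c * (\<rho> - \<epsilon>) \<le> y \<Longrightarrow> y \<le> \<rho> / c + \<epsilon> \<Longrightarrow> \<theta> * \<rho> \<le> f s y"
    and Gge: "\<And>t. t \<in> {a..b} \<Longrightarrow> \<tau> \<le> integral {a..b} (\<lambda>s. G t s * g s)"
  shows "B x < 0"
proof (rule ccontr)
  assume "\<not> B x < 0"
  then have B0: "0 \<le> B x" by simp
  obtain j where j: "j \<le> N" "Y x j = \<rho>" using mu_attained \<rho>(2) by metis
  define r where "r = real j / N"
  have r: "r \<in> {0..1}" using j N_pos by (auto simp: r_def)
  have vr: "v x r = \<rho>" using Y_eq_v[OF j(1), of x] j by (simp add: r_def)
  have cone: "c * \<rho> \<le> v x t" if t: "t \<in> {a..b}" for t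
  proof -
    have t01: "t \<in> {0..1}" using t ab by auto
    have "c * integral {0..1} (\<lambda>s. G r s * k (Y x) s) = integral {0..1} (\<lambda>s. c * (G r s * k (Y x) s))" by simp
    also have "\<dots> \<le> integral {0..1} (\<lambda>s. G t s * k (Y x) s)"
    proof (rule integral_le[OF integrable_on_mult_right[OF green_k_integrable] green_k_integrable])
      fix s :: real assume s: "s \<in> {0..1}"
      show "c * (G r s * k (Y x) s) \<le> G t s * k (Y x) s"
        using mult_right_mono[OF green_cone[OF t r s] k_bounds(1)[OF s]] by (simp add: mult.assoc)
    qed
    finally have 1: "c * integral {0..1} (\<lambda>s. G r s * k (Y x) s) \<le> integral {0..1} (\<lambda>s. G t s * k (Y x) s)" .
    have "c * (beta + alpha * r) / Gam \<le> (beta + alpha * t) / Gam"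
      using line_cone[OF t r] Gam_pos by (intro divide_right_mono) auto
    then have "B x * (c * (beta + alpha * r) / Gam) \<le> B x * ((beta + alpha * t) / Gam)"
      using B0 by (rule mult_left_mono)
    then have "c * v x r \<le> v x t"
      using 1 unfolding v_green[of x] by (simp add: distrib_left mult.left_commute)
    then show ?thesis using vr by simp
  qed
  have kge: "\<theta> * \<rho> * g s \<le> k (Y x) s" if s: "s \<in> {a..b}" for s
  proof -
    have s01: "s \<in> {0..1}" using s ab by auto
    let ?z = "clip P (Y x (cell s))"
    have z: "\<bar>?z - v x s\<bar> \<le> L / N" using clip_Y_near[OF x B0 _ s01 L] \<rho> by simp
    have z2: "?z \<le> \<rho>" using Y_le_mu[OF cell_le[OF s01], of x] \<rho> by (auto simp: clip_def)
    have rc: "\<rho> \<le> \<rho> / c" using c_bounds \<rho> by (simp add: pos_le_divide_eq mult_left_le)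
    have "\<theta> * \<rho> \<le> interp N P (f s) (Y x (cell s))"
    proof (rule interp_ge[OF N_pos])
      fix y assume y: "0 \<le> y" "y \<le> real P" "\<bar>y - ?z\<bar> \<le> 1 / N"
      \<comment> \<open>Freezing loses \<open>L/N\<close>, interpolation another \<open>1/N\<close>;
        the sum fits into the slack \<open>c * \<epsilon>\<close>.\<close>
      have "c * \<rho> - (L + 1) / N \<le> y"
        using cone[OF s] z y by (simp add: add_divide_distrib)
      then have "c * (\<rho> - \<epsilon>) \<le> y" using N by (simp add: right_diff_distrib)
      moreover have "y \<le> \<rho> / c + \<epsilon>" using y z2 rc N by linarith
      ultimately show "\<theta> * \<rho> \<le> f s y" by (intro fge s y)
    qed
    then show ?thesis using g_nonneg[OF s01] by (simp add: k_def mult.commute mult_left_mono)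
  qed
  \<comment> \<open>Since \<open>\<rho>\<close> bounds the solution at nodes only, the contradiction
    must occur at a node. The first node at or after \<open>a\<close> lies in \<open>[a,b]\<close>
    because \<open>1/N \<le> b - a\<close>.\<close>
  define i where "i = nat \<lceil>real N * a\<rceil>"
  have "real i = of_int \<lceil>real N * a\<rceil>" using ab by (simp add: i_def)
  then have "real N * a \<le> real i" "real i < real N * a + 1" by linarith+
  then have ia: "a \<le> real i / N" "real i / N < a + 1 / N" using N_pos by (auto simp: field_simps)
  define t where "t = real i / N"
  have t: "t \<in> {a..b}" using ia N by (auto simp: t_def)
  have t01: "t \<in> {0..1}" using t ab by auto
  have "real i \<le> real N" using t01 N_pos by (simp add: t_def field_simps)
  then have i: "i \<le> N" by simp
  have "v x t \<le> \<rho>" using Y_le_mu[OF i, of x] Y_eq_v[OF i, of x] \<rho> by (simp add: t_def)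
  moreover have "\<rho> < v x t"
  proof -
    have abs: "{a..b} \<subseteq> {0..1}" using ab by auto
    have "\<rho> * 1 < \<rho> * (\<theta> * \<tau>)" using \<theta> \<rho> by (intro mult_strict_left_mono) auto
    also have "\<dots> = \<theta> * \<rho> * \<tau>" by simp
    also have "\<dots> \<le> \<theta> * \<rho> * integral {a..b} (\<lambda>s. G t s * g s)"
      using Gge[OF t] \<theta> \<rho> by (simp add: mult_left_mono)
    also have "\<dots> = integral {a..b} (\<lambda>s. \<theta> * \<rho> * (G t s * g s))" by simp
    also have "\<dots> \<le> integral {a..b} (\<lambda>s. G t s * k (Y x) s)"
    proof (rule integral_le[OF integrable_on_mult_right[OF integrable_on_subinterval[OF green_g_integrable abs]]
              integrable_on_subinterval[OF green_k_integrable abs]])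
      fix s :: real assume s: "s \<in> {a..b}"
      then have "s \<in> {0..1}" using ab by auto
      then show "\<theta> * \<rho> * (G t s * g s) \<le> G t s * k (Y x) s"
        using mult_left_mono[OF kge[OF s] green_nonneg[OF t01]] by (simp add: mult.left_commute mult.assoc)
    qed
    also have "\<dots> \<le> integral {0..1} (\<lambda>s. G t s * k (Y x) s)"
      using t01 by (intro integral_subset_le abs integrable_on_subinterval[OF green_k_integrable abs]
            green_k_integrable ballI mult_nonneg_nonneg green_nonneg k_bounds)
    also have "\<dots> \<le> v x t"
      using v_green[of x t] B0 params t01 Gam_pos by simp
    finally show ?thesis by simp
  qed
  ultimately show False by simp
qed

text \<open>The last two conclusions are all that the limit passage retains of the discretisation:
  \<open>h s\<close> respects every bound that \<open>f s\<close> has within distance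
  \<open>(L + 1)/N\<close> of \<open>V s\<close>. The names \<open>\<rho>p\<close> and
  \<open>\<rho>m\<close> mark the levels where the defect is positive and negative.\<close>

lemma approximate_solution:
  assumes \<rho>: "0 < \<rho>1" "\<rho>1 < \<rho>2" "\<rho>2 \<le> real P"
    and alt: "\<rho>m = \<rho>1 \<and> \<rho>p = \<rho>2 \<or> \<rho>p = \<rho>1 \<and> \<rho>m = \<rho>2"
    and L: "L = alpha * ((\<rho>2 + R * integral {0..1} g) / (alpha + beta)) + R * integral {0..1} g"
    and N: "1 / N \<le> \<epsilon>p" "(L + 1) / N \<le> c * \<epsilon>m" "1 / N \<le> \<epsilon>m" "1 / N \<le> b - a"
    and \<theta>p: "0 \<le> \<theta>p" "\<theta>p * \<sigma> < 1"
    and fle: "\<And>s y. s \<in> {0..1} \<Longrightarrow> 0 \<le> y \<Longrightarrow> y \<le> \<rho>p + \<epsilon>p \<Longrightarrow> f s y \<le> \<theta>p * \<rho>p"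
    and Gle: "\<And>t. t \<in> {0..1} \<Longrightarrow> integral {0..1} (\<lambda>s. G t s * g s) \<le> \<sigma>"
    and \<theta>m: "0 \<le> \<theta>m" "1 < \<theta>m * \<tau>"
    and fge: "\<And>s y. s \<in> {a..b} \<Longrightarrow> 0 \<le> y \<Longrightarrow> c * (\<rho>m - \<epsilon>m) \<le> y \<Longrightarrow> y \<le> \<rho>m / c + \<epsilon>m \<Longrightarrow> \<theta>m * \<rho>m \<le> f s y"
    and Gge: "\<And>t. t \<in> {a..b} \<Longrightarrow> \<tau> \<le> integral {a..b} (\<lambda>s. G t s * g s)"
  obtains x h V where "0 \<le> x" "x \<le> (\<rho>2 + R * integral {0..1} g) / (alpha + beta)"
    "(\<lambda>s. g s * h s) absolutely_integrable_on {0..1}"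
    "\<forall>s\<in>{0..1}. 0 \<le> g s * h s \<and> g s * h s \<le> R * g s"
    "\<forall>t. V t = (beta + alpha * t) * x - integral {0..1} (\<lambda>s. max 0 (t - s) * (g s * h s))"
    "\<forall>t\<in>{0..1}. 0 \<le> V t"
    "gam * V 1 + delta * (alpha * x - integral {0..1} (\<lambda>s. g s * h s)) = 0"
    "\<exists>t\<in>{0..1}. \<rho>1 \<le> V t"
    "\<forall>s\<in>{0..1}. \<forall>lo. (\<forall>y\<ge>0. \<bar>y - V s\<bar> \<le> (L + 1) / N \<longrightarrow> lo \<le> f s y) \<longrightarrow> lo \<le> h s"
    "\<forall>s\<in>{0..1}. \<forall>hi. (\<forall>y\<ge>0. \<bar>y - V s\<bar> \<le> (L + 1) / N \<longrightarrow> f s y \<le> hi) \<longrightarrow> h s \<le> hi"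
proof -
  have Lx: "alpha * x + R * integral {0..1} g \<le> L" if "mu x \<le> \<rho>2" for x
    unfolding L using mult_left_mono[OF shooting_bound[OF that] params(1)] by simp
  have \<rho>pm: "0 < \<rho>p" "\<rho>p \<le> \<rho>2" "0 < \<rho>m" "\<rho>m \<le> \<rho>2" using alt \<rho> by auto
  have pos: "0 < B x" if "mu x = \<rho>p" for x
    by (rule B_pos[OF \<rho>pm(1) that \<theta>p _ Gle]) (use fle N in auto)
  have neg: "B x < 0" if "mu x = \<rho>m" "0 \<le> x" for x
    by (rule B_neg[OF \<rho>pm(3) that(1) _ that(2) \<theta>m Lx N(2-4) fge Gge]) (use that \<rho>pm \<rho> in auto)
  obtain x where x: "0 \<le> x" "\<rho>1 \<le> mu x" "mu x \<le> \<rho>2" "B x = 0"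
    by (rule exists_root[OF \<rho>(1,2)]) (use alt pos neg in auto)
  define h where "h s = interp N P (f s) (Y x (cell s))" for s
  have kh: "k (Y x) = (\<lambda>s. g s * h s)" by (auto simp: k_def h_def)
  have near: "\<bar>y - v x s\<bar> \<le> (L + 1) / N" if "s \<in> {0..1}" "\<bar>y - clip P (Y x (cell s))\<bar> \<le> 1 / N" for s y
    using clip_Y_near[OF x(1) _ _ that(1) Lx] that x \<rho> by (simp add: add_divide_distrib)
  show thesis
  proof (rule that[of x h "v x"])
    show "(\<lambda>s. g s * h s) absolutely_integrable_on {0..1}" using k_int[of "Y x"] by (simp add: kh)
    show "\<forall>s\<in>{0..1}. 0 \<le> g s * h s \<and> g s * h s \<le> R * g s" using k_bounds[of _ "Y x"] by (simp add: kh)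
    show "\<forall>t. v x t = (beta + alpha * t) * x - integral {0..1} (\<lambda>s. max 0 (t - s) * (g s * h s))"
      by (simp add: v_def kh)
    show "\<forall>t\<in>{0..1}. 0 \<le> v x t" using v_nonneg x by simp
    show "gam * v x 1 + delta * (alpha * x - integral {0..1} (\<lambda>s. g s * h s)) = 0"
      using x(4) by (simp add: B_def kh)
    obtain j where j: "j \<le> N" "Y x j = mu x" by (rule mu_attained)
    then show "\<exists>t\<in>{0..1}. \<rho>1 \<le> v x t"
      using x(2) Y_eq_v[OF j(1), of x] N_pos by (intro bexI[of _ "real j / N"]) auto
    show "\<forall>s\<in>{0..1}. \<forall>lo. (\<forall>y\<ge>0. \<bar>y - v x s\<bar> \<le> (L + 1) / N \<longrightarrow> lo \<le> f s y) \<longrightarrow> lo \<le> h s"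
      unfolding h_def using near by (auto intro!: interp_ge[OF N_pos])
    show "\<forall>s\<in>{0..1}. \<forall>hi. (\<forall>y\<ge>0. \<bar>y - v x s\<bar> \<le> (L + 1) / N \<longrightarrow> f s y \<le> hi) \<longrightarrow> h s \<le> hi"
      unfolding h_def using near by (auto intro!: interp_le[OF N_pos])
  qed (use x shooting_bound in auto)
qed

end


section \<open>Passage to the limit\<close>

text \<open>The limit function need not be a primitive known in advance. It suffices that its
  increments lie between those of \<open>lo n\<close> and \<open>up n\<close>, whose slopes at the
  one point \<open>t\<close> pinch \<open>Q\<close>.\<close>

lemma has_real_derivative_squeeze:
  fixes w :: "real \<Rightarrow> real" and lo up l p :: "nat \<Rightarrow> real \<Rightarrow> real"
  assumes r: "r < t" "t < s"
    and w: "\<And>n x y. r \<le> x \<Longrightarrow> x \<le> y \<Longrightarrow> y \<le> s \<Longrightarrow> lo n y - lo n x \<le> w y - w x \<and> w y - w x \<le> up n y - up n x"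
    and lo: "\<And>n. (lo n has_real_derivative l n t) (at t)" and up: "\<And>n. (up n has_real_derivative p n t) (at t)"
    and Q: "\<And>e. 0 < e \<Longrightarrow> \<exists>n. Q - e \<le> l n t \<and> p n t \<le> Q + e"
  shows "(w has_real_derivative Q) (at t)"
  unfolding has_real_derivative_at_alt
proof (intro allI impI)
  fix e :: real assume e: "0 < e"
  then obtain n where n: "Q - e/2 \<le> l n t" "p n t \<le> Q + e/2" using Q[of "e/2"] by auto
  obtain d1 where d1: "d1 > 0" "\<And>y. \<bar>y - t\<bar> < d1 \<Longrightarrow> \<bar>lo n y - lo n t - l n t * (y - t)\<bar> \<le> e/2 * \<bar>y - t\<bar>"
    using lo[of n] e unfolding has_real_derivative_at_alt by (metis half_gt_zero)
  obtain d2 where d2: "d2 > 0" "\<And>y. \<bar>y - t\<bar> < d2 \<Longrightarrow> \<bar>up n y - up n t - p n t * (y - t)\<bar> \<le> e/2 * \<bar>y - t\<bar>"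
    using up[of n] e unfolding has_real_derivative_at_alt by (metis half_gt_zero)
  define d where "d = min (min d1 d2) (min (t - r) (s - t))"
  have "d > 0" using d1 d2 r by (auto simp: d_def)
  moreover have "\<bar>w y - w t - Q * (y - t)\<bar> \<le> e * \<bar>y - t\<bar>" if y: "\<bar>y - t\<bar> < d" for y
  proof -
    have a1: "\<bar>lo n y - lo n t - l n t * (y - t)\<bar> \<le> e/2 * \<bar>y - t\<bar>"
      and a2: "\<bar>up n y - up n t - p n t * (y - t)\<bar> \<le> e/2 * \<bar>y - t\<bar>"
      using d1(2)[of y] d2(2)[of y] y by (auto simp: d_def)
    have ee: "e * \<bar>y - t\<bar> = 2 * (e/2 * \<bar>y - t\<bar>)" by simp
    show ?thesis
    proof (cases "t \<le> y")
      case True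
      then have "(Q - e/2) * (y - t) \<le> l n t * (y - t)" "p n t * (y - t) \<le> (Q + e/2) * (y - t)"
        using n by (auto intro!: mult_right_mono)
      then have "Q * (y - t) - e/2 * \<bar>y - t\<bar> \<le> l n t * (y - t)" "p n t * (y - t) \<le> Q * (y - t) + e/2 * \<bar>y - t\<bar>"
        using True by (auto simp only: left_diff_distrib distrib_right abs_of_nonneg diff_ge_0_iff_ge)
      moreover have "lo n y - lo n t \<le> w y - w t \<and> w y - w t \<le> up n y - up n t"
        using True y r by (intro w) (auto simp: d_def)
      ultimately show ?thesis
        using a1 a2 unfolding ee by linarith
    next
      case False
      then have "l n t * (y - t) \<le> (Q - e/2) * (y - t)" "(Q + e/2) * (y - t) \<le> p n t * (y - t)"
        using n by (auto intro!: mult_right_mono_neg)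
      moreover have "\<bar>y - t\<bar> = - (y - t)" using False by simp
      ultimately have "l n t * (y - t) \<le> Q * (y - t) + e/2 * \<bar>y - t\<bar>" "Q * (y - t) - e/2 * \<bar>y - t\<bar> \<le> p n t * (y - t)"
        by (simp_all only: left_diff_distrib distrib_right mult_minus_right)
      moreover have "lo n t - lo n y \<le> w t - w y \<and> w t - w y \<le> up n t - up n y"
        using False y r by (intro w) (auto simp: d_def)
      ultimately show ?thesis
        using a1 a2 unfolding ee by linarith
    qed
  qed
  ultimately show "\<exists>d>0. \<forall>y. \<bar>y - t\<bar> < d \<longrightarrow> \<bar>w y - w t - Q * (y - t)\<bar> \<le> e * \<bar>y - t\<bar>" by blast
qed

lemma has_real_derivative_le:
  fixes w up :: "real \<Rightarrow> real"
  assumes r: "r < t" "t < s"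
    and w: "\<And>x y. r \<le> x \<Longrightarrow> x \<le> y \<Longrightarrow> y \<le> s \<Longrightarrow> w y - w x \<le> up y - up x"
    and D: "(w has_real_derivative D) (at t)" and p: "(up has_real_derivative p) (at t)"
  shows "D \<le> p"
proof -
  have "mono_on {r..s} (\<lambda>x. up x - w x)"
    using w by (intro mono_onI) (fastforce simp: algebra_simps)
  moreover have "((\<lambda>x. up x - w x) has_real_derivative p - D) (at t)"
    by (intro derivative_intros p D)
  ultimately have "p - D \<ge> 0"
    using r by (intro mono_on_imp_deriv_nonneg[of "{r..s}" "\<lambda>x. up x - w x" _ t]) auto
  then show ?thesis by simp
qed

text \<open>The convergent subsequence, with \<open>\<eta>\<close> the radius of the neighbourhoods
  sampled by \<open>h\<close>. The function \<open>w\<close> is the limit of the primitives of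
  \<open>g h\<close>, so the slope of the limit solution is \<open>alpha * x - w\<close>.\<close>

locale shooting_limit = sturm_liouville +
  fixes f :: "real \<Rightarrow> real \<Rightarrow> real" and g :: "real \<Rightarrow> real" and R \<rho> :: real
    and xs \<eta> :: "nat \<Rightarrow> real" and h :: "nat \<Rightarrow> real \<Rightarrow> real" and V :: "nat \<Rightarrow> real \<Rightarrow> real"
    and w :: "real \<Rightarrow> real" and x :: real
  assumes g_int: "g absolutely_integrable_on {0..1}"
    and g_nonneg: "\<And>t. t \<in> {0..1} \<Longrightarrow> 0 \<le> g t"
    and R_nonneg: "0 \<le> R"
    and q_int: "\<And>n. (\<lambda>s. g s * h n s) absolutely_integrable_on {0..1}"
    and q_bounds: "\<And>n s. s \<in> {0..1} \<Longrightarrow> 0 \<le> g s * h n s \<and> g s * h n s \<le> R * g s"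
    and V_eq: "\<And>n t. V n t = (beta + alpha * t) * xs n - integral {0..1} (\<lambda>s. max 0 (t - s) * (g s * h n s))"
    and V_nonneg: "\<And>n t. t \<in> {0..1} \<Longrightarrow> 0 \<le> V n t"
    and V_right: "\<And>n. gam * V n 1 + delta * (alpha * xs n - integral {0..1} (\<lambda>s. g s * h n s)) = 0"
    and \<rho>_pos: "0 < \<rho>" and V_large: "\<And>n. \<exists>t\<in>{0..1}. \<rho> \<le> V n t"
    and h_ge: "\<And>n s lo. s \<in> {0..1} \<Longrightarrow> (\<forall>y\<ge>0. \<bar>y - V n s\<bar> \<le> \<eta> n \<longrightarrow> lo \<le> f s y) \<Longrightarrow> lo \<le> h n s"
    and h_le: "\<And>n s hi. s \<in> {0..1} \<Longrightarrow> (\<forall>y\<ge>0. \<bar>y - V n s\<bar> \<le> \<eta> n \<longrightarrow> f s y \<le> hi) \<Longrightarrow> h n s \<le> hi"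
    and \<eta>: "\<eta> \<longlonglongrightarrow> 0"
    and w_lim: "uniform_limit {0..1} (\<lambda>n t. integral {0..t} (\<lambda>s. g s * h n s)) w sequentially"
    and x_lim: "xs \<longlonglongrightarrow> x"
begin

abbreviation q :: "nat \<Rightarrow> real \<Rightarrow> real" where "q n s \<equiv> g s * h n s"
definition W :: "nat \<Rightarrow> real \<Rightarrow> real" where "W n t = integral {0..t} (q n)"
definition v :: "real \<Rightarrow> real" where "v t = (beta + alpha * t) * x - integral {0..t} w"

lemmas q_integrable = absolutely_integrable_imp_integrable[OF q_int]
lemmas g_integrable = absolutely_integrable_imp_integrable[OF g_int]

lemma Rg_int: "(\<lambda>s. R * g s) absolutely_integrable_on {0..1}"
  using g_int by (rule absolutely_integrable_continuous_mult[OF continuous_on_const])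

lemma W_lim: "uniform_limit {0..1} W w sequentially"
  using w_lim unfolding W_def[abs_def] .

lemma W_tendsto: "t \<in> {0..1} \<Longrightarrow> (\<lambda>n. W n t) \<longlonglongrightarrow> w t"
  using W_lim by (rule tendsto_uniform_limitI)

lemma continuous_W: "continuous_on {0..1} (W n)"
  unfolding W_def[abs_def] by (rule indefinite_integral_continuous_1[OF q_integrable])

lemma continuous_w: "continuous_on {0..1} w"
  by (rule uniform_limit_theorem[OF _ W_lim]) (simp_all add: continuous_W)

lemma W_diff:
  assumes "0 \<le> s" "s \<le> t" "t \<le> 1"
  shows "W n t - W n s = integral {s..t} (q n)"
  unfolding W_def using assms by (intro integral_diff_real[OF q_integrable]) auto

lemma w_diff_bounds:
  assumes "0 \<le> s" "s \<le> t" "t \<le> 1"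
    and l: "l integrable_on {0..1}" "\<And>m z. n \<le> m \<Longrightarrow> z \<in> {0..1} \<Longrightarrow> l z \<le> q m z"
    and p: "p integrable_on {0..1}" "\<And>m z. n \<le> m \<Longrightarrow> z \<in> {0..1} \<Longrightarrow> q m z \<le> p z"
  shows "integral {s..t} l \<le> w t - w s" "w t - w s \<le> integral {s..t} p"
proof -
  have sub: "{s..t} \<subseteq> {0..1}" using assms by auto
  have lim: "(\<lambda>m. W m t - W m s) \<longlonglongrightarrow> w t - w s"
    using assms by (intro tendsto_diff W_tendsto) auto
  show "integral {s..t} l \<le> w t - w s"
  proof (rule LIMSEQ_le_const[OF lim], intro exI[of _ n] allI impI)
    fix m assume "n \<le> m"
    then show "integral {s..t} l \<le> W m t - W m s"
      unfolding W_diff[OF assms(1-3)] using l sub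
      by (intro integral_le integrable_on_subinterval[OF l(1)] integrable_on_subinterval[OF q_integrable]) auto
  qed
  show "w t - w s \<le> integral {s..t} p"
  proof (rule LIMSEQ_le_const2[OF lim], intro exI[of _ n] allI impI)
    fix m assume "n \<le> m"
    then show "W m t - W m s \<le> integral {s..t} p"
      unfolding W_diff[OF assms(1-3)] using p sub
      by (intro integral_le integrable_on_subinterval[OF p(1)] integrable_on_subinterval[OF q_integrable]) auto
  qed
qed

lemma w_abs_diff:
  assumes "0 \<le> s" "s \<le> t" "t \<le> 1"
  shows "\<bar>w t - w s\<bar> \<le> integral {s..t} (\<lambda>z. R * g z)"
proof -
  have "integral {s..t} (\<lambda>z. 0) \<le> w t - w s" "w t - w s \<le> integral {s..t} (\<lambda>z. R * g z)"
    using w_diff_bounds[OF assms, of "\<lambda>_. 0" 0 "\<lambda>z. R * g z"] q_bounds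
      absolutely_integrable_imp_integrable[OF Rg_int] by auto
  then show ?thesis by simp
qed

lemma w_0: "w 0 = 0"
  using W_tendsto[of 0] by (simp add: W_def LIMSEQ_const_iff)

text \<open>The derivative of the ramp integral is \<open>W n\<close>, so the fundamental theorem of
  calculus rewrites it as an integral of \<open>W n\<close>, where uniform convergence can be
  used.\<close>

lemma V_eq_W:
  assumes t: "t \<in> {0..1}"
  shows "V n t = (beta + alpha * t) * xs n - integral {0..t} (W n)"
proof -
  let ?I = "\<lambda>t. integral {0..1} (\<lambda>s. max 0 (t - s) * q n s)"
  have "(?I has_real_derivative W n z) (at z within {0..t})" if "z \<in> {0..t}" for z
    unfolding W_def by (rule DERIV_subset[OF integral_ramp_has_derivative[OF q_int]]) (use that t in auto)
  then have "(W n has_integral (?I t - ?I 0)) {0..t}"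
    using t by (intro fundamental_theorem_of_calculus)
      (auto simp: has_real_derivative_iff_has_vector_derivative[symmetric])
  moreover have "?I 0 = integral {0..1} (\<lambda>s::real. 0)"
    by (intro integral_cong) auto
  ultimately have "integral {0..t} (W n) = ?I t" by (auto dest!: integral_unique)
  then show ?thesis by (simp add: V_eq)
qed

lemma V_lim: "uniform_limit {0..1} V v sequentially"
proof (rule uniform_limitI)
  fix e :: real assume e: "0 < e"
  define e' where "e' = e / (2 * (alpha + beta + 1))"
  have e': "e' > 0" "(alpha + beta) * e' < e / 2"
    using e params sum_pos by (auto simp: e'_def field_simps intro!: divide_pos_pos)
  have "\<forall>\<^sub>F n in sequentially. \<forall>t\<in>{0..1}. dist (W n t) (w t) < e / 2"
    using uniform_limitD[OF W_lim, of "e/2"] e by simp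
  moreover have "\<forall>\<^sub>F n in sequentially. dist (xs n) x < e'"
    using x_lim e' by (auto dest: tendstoD)
  ultimately show "\<forall>\<^sub>F n in sequentially. \<forall>t\<in>{0..1}. dist (V n t) (v t) < e"
  proof eventually_elim
    case (elim n)
    show ?case
    proof
      fix t :: real assume t: "t \<in> {0..1}"
      have sub: "{0..t} \<subseteq> {0..1}" using t by auto
      have Wi: "W n integrable_on {0..t}" and wi: "w integrable_on {0..t}"
        using continuous_on_subset[OF continuous_W sub] continuous_on_subset[OF continuous_w sub]
        by (auto intro: integrable_continuous_real)
      have "\<bar>integral {0..t} (W n) - integral {0..t} w\<bar> = norm (integral {0..t} (\<lambda>z. W n z - w z))"
        by (simp add: Henstock_Kurzweil_Integration.integral_diff[OF Wi wi])
      also have "\<dots> \<le> integral {0..t} (\<lambda>_. e / 2)"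
        using elim(1) sub
        by (intro Henstock_Kurzweil_Integration.integral_norm_bound_integral integrable_diff Wi wi)
          (auto simp: dist_real_def intro: less_imp_le)
      also have "\<dots> \<le> e / 2" using t e by (simp add: mult_left_le_one_le)
      finally have 1: "\<bar>integral {0..t} (W n) - integral {0..t} w\<bar> \<le> e / 2" .
      have "\<bar>(beta + alpha * t) * (xs n - x)\<bar> \<le> (alpha + beta) * e'"
        unfolding abs_mult using elim(2) params t
        by (intro mult_mono) (auto simp: dist_real_def mult_left_le)
      then show "dist (V n t) (v t) < e"
        using 1 e'(2) unfolding V_eq_W[OF t] v_def dist_real_def right_diff_distrib by linarith
    qed
  qed
qed

lemma V_tendsto: "t \<in> {0..1} \<Longrightarrow> (\<lambda>n. V n t) \<longlonglongrightarrow> v t"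
  using V_lim by (rule tendsto_uniform_limitI)

lemma v_nonneg: "t \<in> {0..1} \<Longrightarrow> 0 \<le> v t"
  by (rule LIMSEQ_le_const[OF V_tendsto]) (auto simp: V_nonneg)

text \<open>Every approximation reaches the positive level \<rho> somewhere, and uniform convergence
  forbids all of this height from vanishing.\<close>

lemma v_nontrivial: "\<exists>t\<in>{0..1}. v t \<noteq> 0"
proof (rule ccontr)
  assume "\<not> ?thesis"
  then have v0: "\<And>t. t \<in> {0..1} \<Longrightarrow> v t = 0" by auto
  have "\<forall>\<^sub>F n in sequentially. \<forall>t\<in>{0..1}. dist (V n t) (v t) < \<rho>"
    using uniform_limitD[OF V_lim \<rho>_pos] .
  then obtain n where "\<forall>t\<in>{0..1}. dist (V n t) (v t) < \<rho>"
    by (auto simp: eventually_sequentially)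
  moreover obtain t where "t \<in> {0..1}" "\<rho> \<le> V n t" using V_large by blast
  ultimately show False using v0 by (force simp: dist_real_def)
qed

lemma v_derivative:
  assumes t: "t \<in> {0..1}"
  shows "(v has_real_derivative alpha * x - w t) (at t within {0..1})"
  unfolding v_def[abs_def]
  by (rule derivative_eq_intros integral_has_real_derivative[OF continuous_w t] refl)+ simp

lemma v_W21: "W21_on 0 1 v (\<lambda>t. alpha * x - w t)"
proof -
  have "abs_cont_on 0 1 (\<lambda>t. alpha * x - w t)"
  proof (rule abs_cont_on_dominated[OF Rg_int])
    show "0 \<le> R * g t" if "t \<in> {0..1}" for t using g_nonneg[OF that] R_nonneg by simp
    show "\<bar>(alpha * x - w y) - (alpha * x - w z)\<bar> \<le> integral {z..y} (\<lambda>s. R * g s)"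
      if "0 \<le> z" "z \<le> y" "y \<le> 1" for z y
      using w_abs_diff[OF that] by (simp add: abs_minus_commute)
  qed
  then show ?thesis
    unfolding W21_on_def using v_derivative continuous_w by (auto intro!: continuous_intros)
qed

lemma v_left: "alpha * v 0 - beta * (alpha * x - w 0) = 0"
  by (simp add: v_def w_0)

lemma v_right: "gam * v 1 + delta * (alpha * x - w 1) = 0"
proof -
  have "(\<lambda>n. gam * V n 1 + delta * (alpha * xs n - W n 1)) \<longlonglongrightarrow> gam * v 1 + delta * (alpha * x - w 1)"
    by (intro tendsto_intros V_tendsto W_tendsto x_lim) auto
  then show ?thesis using V_right by (simp add: W_def LIMSEQ_const_iff)
qed

section \<open>Tail envelopes and the derivative of the limit\<close>

definition p :: "nat \<Rightarrow> real \<Rightarrow> real" where "p n s = (SUP m\<in>{n..}. q m s)"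
definition l :: "nat \<Rightarrow> real \<Rightarrow> real" where "l n s = (INF m\<in>{n..}. q m s)"

lemma q_bdd: "s \<in> {0..1} \<Longrightarrow> bdd_above ((\<lambda>m. q m s) ` {n..})" "s \<in> {0..1} \<Longrightarrow> bdd_below ((\<lambda>m. q m s) ` {n..})"
  using q_bounds by (auto intro!: bdd_aboveI2 bdd_belowI2)

lemma l_le_q: "n \<le> m \<Longrightarrow> s \<in> {0..1} \<Longrightarrow> l n s \<le> q m s"
  unfolding l_def by (intro cINF_lower q_bdd) auto

lemma q_le_p: "n \<le> m \<Longrightarrow> s \<in> {0..1} \<Longrightarrow> q m s \<le> p n s"
  unfolding p_def by (intro cSUP_upper q_bdd) auto

lemma lp_bounds:
  assumes "s \<in> {0..1}"
  shows "0 \<le> l n s" "l n s \<le> R * g s" "0 \<le> p n s" "p n s \<le> R * g s"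
proof -
  show "0 \<le> l n s" unfolding l_def using q_bounds[OF assms] by (intro cINF_greatest) auto
  show "p n s \<le> R * g s" unfolding p_def using q_bounds[OF assms] by (intro cSUP_least) auto
  show "l n s \<le> R * g s" "0 \<le> p n s"
    using l_le_q[of n n s] q_le_p[of n n s] q_bounds[OF assms, of n] assms by auto
qed

lemma lp_integrable: "l n integrable_on {0..1}" "p n integrable_on {0..1}"
proof -
  have qm: "(\<lambda>s. q m s) \<in> borel_measurable (lebesgue_on {0..1})" for m
    using q_int[of m] by (subst (asm) absolutely_integrable_measurable) auto
  have Rg: "(\<lambda>s. R * g s) integrable_on {0..1}" using absolutely_integrable_imp_integrable[OF Rg_int] .
  have "l n \<in> borel_measurable (lebesgue_on {0..1})"
    unfolding l_def[abs_def] using q_bdd by (intro borel_measurable_cINF qm) auto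
  then show "l n integrable_on {0..1}"
    using lp_bounds by (intro measurable_bounded_by_integrable_imp_integrable[OF _ Rg]) auto
  have "p n \<in> borel_measurable (lebesgue_on {0..1})"
    unfolding p_def[abs_def] using q_bdd by (intro borel_measurable_cSUP qm) auto
  then show "p n integrable_on {0..1}"
    using lp_bounds by (intro measurable_bounded_by_integrable_imp_integrable[OF _ Rg]) auto
qed

text \<open>Increments of \<open>w\<close> lie between the integrals of \<open>l n\<close> and
  \<open>p n\<close>. Countably many envelopes have a common set of full measure on which all their
  primitives are differentiable. There, convergence of \<open>q m t\<close> closes the gap between
  the envelopes, and without convergence any existing derivative is still trapped.\<close>

lemma w_derivative_AE:
  obtains N where "negligible N"
    "\<And>t Q. t \<in> {0<..<1} - N \<Longrightarrow> (\<lambda>m. q m t) \<longlonglongrightarrow> Q \<Longrightarrow> (w has_real_derivative Q) (at t)"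
    "\<And>t D n. t \<in> {0<..<1} - N \<Longrightarrow> (w has_real_derivative D) (at t) \<Longrightarrow> l n t \<le> D \<and> D \<le> p n t"
proof -
  have "\<exists>N. negligible N \<and> (\<forall>t\<in>{0<..<1} - N. ((\<lambda>x. integral {0..x} (l n)) has_real_derivative l n t) (at t))" for n
    by (rule integral_has_real_derivative_AE[OF lp_integrable(1)[of n]]) blast
  then have "\<exists>N1. \<forall>n. negligible (N1 n) \<and>
      (\<forall>t\<in>{0<..<1} - N1 n. ((\<lambda>x. integral {0..x} (l n)) has_real_derivative l n t) (at t))"
    by (intro choice allI)
  then obtain N1 where N1: "\<And>n. negligible (N1 n)"
    "\<And>n t. t \<in> {0<..<1} - N1 n \<Longrightarrow> ((\<lambda>x. integral {0..x} (l n)) has_real_derivative l n t) (at t)"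
    by blast
  have "\<exists>N. negligible N \<and> (\<forall>t\<in>{0<..<1} - N. ((\<lambda>x. integral {0..x} (p n)) has_real_derivative p n t) (at t))" for n
    by (rule integral_has_real_derivative_AE[OF lp_integrable(2)[of n]]) blast
  then have "\<exists>N2. \<forall>n. negligible (N2 n) \<and>
      (\<forall>t\<in>{0<..<1} - N2 n. ((\<lambda>x. integral {0..x} (p n)) has_real_derivative p n t) (at t))"
    by (intro choice allI)
  then obtain N2 where N2: "\<And>n. negligible (N2 n)"
    "\<And>n t. t \<in> {0<..<1} - N2 n \<Longrightarrow> ((\<lambda>x. integral {0..x} (p n)) has_real_derivative p n t) (at t)"
    by blast
  define lo up where "lo n x = integral {0..x} (l n)" and "up n x = integral {0..x} (p n)" for n x
  have wb: "lo n y - lo n z \<le> w y - w z \<and> w y - w z \<le> up n y - up n z" if "0 \<le> z" "z \<le> y" "y \<le> 1" for n y z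
    unfolding lo_def up_def integral_diff_real[OF lp_integrable(1) that] integral_diff_real[OF lp_integrable(2) that]
    using w_diff_bounds[OF that lp_integrable(1) l_le_q lp_integrable(2) q_le_p] by blast
  have neg: "negligible ((\<Union>n. N1 n) \<union> (\<Union>n. N2 n))"
    by (intro negligible_Un negligible_Union_nat N1 N2)
  show thesis
  proof (rule that[OF neg])
    fix t assume t: "t \<in> {0<..<1} - ((\<Union>n. N1 n) \<union> (\<Union>n. N2 n))"
    have dlo: "(lo n has_real_derivative l n t) (at t)" and dup: "(up n has_real_derivative p n t) (at t)" for n
      unfolding lo_def[abs_def] up_def[abs_def] using N1(2)[of t n] N2(2)[of t n] t by auto
    have t01: "0 < t" "t < 1" using t by auto
    show "l n t \<le> D \<and> D \<le> p n t" if D: "(w has_real_derivative D) (at t)" for D n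
      using has_real_derivative_le[OF t01 _ D dup[of n]] has_real_derivative_le[OF t01 _ dlo[of n] D] wb by blast
    show "(w has_real_derivative Q) (at t)" if Q: "(\<lambda>m. q m t) \<longlonglongrightarrow> Q" for Q
    proof (rule has_real_derivative_squeeze[where lo = lo and up = up and l = l and p = p, OF t01 wb dlo dup])
      fix e :: real assume "0 < e"
      then obtain n where n: "\<And>m. n \<le> m \<Longrightarrow> \<bar>q m t - Q\<bar> < e"
        using Q by (metis LIMSEQ_iff real_norm_def)
      have "Q - e \<le> l n t" unfolding l_def using n by (intro cINF_greatest) (auto simp: abs_less_iff, smt (verit))
      moreover have "p n t \<le> Q + e" unfolding p_def using n by (intro cSUP_least) (auto simp: abs_less_iff, smt (verit))
      ultimately show "\<exists>n. Q - e \<le> l n t \<and> p n t \<le> Q + e" by blast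
    qed
  qed
qed

lemma eventually_near:
  assumes t: "t \<in> {0..1}" and e: "0 < e"
  shows "\<forall>\<^sub>F n in sequentially. \<forall>y. \<bar>y - V n t\<bar> \<le> \<eta> n \<longrightarrow> \<bar>y - v t\<bar> < e"
proof -
  have "\<forall>\<^sub>F n in sequentially. dist (V n t) (v t) < e/2" "\<forall>\<^sub>F n in sequentially. dist (\<eta> n) 0 < e/2"
    using tendstoD[OF V_tendsto[OF t], of "e/2"] tendstoD[OF \<eta>, of "e/2"] e by auto
  then show ?thesis
  proof eventually_elim
    case (elim n)
    then show ?case unfolding dist_real_def by (intro allI impI) linarith
  qed
qed

text \<open>Near \<open>v t\<close> the values of \<open>f t\<close> are almost constant, and
  eventually the whole sampling neighbourhood of \<open>V m t\<close> lies in that region, so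
  \<open>h m t\<close> is trapped as well.\<close>

lemma q_tendsto:
  assumes t: "t \<in> {0..1}" and c: "continuous (at (v t) within {0..}) (f t)"
  shows "(\<lambda>m. q m t) \<longlonglongrightarrow> g t * f t (v t)"
proof -
  have "(\<lambda>m. h m t) \<longlonglongrightarrow> f t (v t)"
  proof (rule tendstoI)
    fix e :: real assume e: "0 < e"
    then obtain d where d: "d > 0" "\<And>y. 0 \<le> y \<Longrightarrow> \<bar>y - v t\<bar> < d \<Longrightarrow> \<bar>f t y - f t (v t)\<bar> < e / 2"
      using c unfolding continuous_within_eps_delta by (metis atLeast_iff dist_real_def half_gt_zero)
    show "\<forall>\<^sub>F m in sequentially. dist (h m t) (f t (v t)) < e"
      using eventually_near[OF t d(1)]
    proof eventually_elim
      case (elim m)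
      have "f t (v t) - e/2 \<le> h m t"
      proof (rule h_ge[OF t], intro allI impI)
        fix y assume "0 \<le> y" "\<bar>y - V m t\<bar> \<le> \<eta> m"
        then have "\<bar>f t y - f t (v t)\<bar> < e / 2" using elim by (intro d(2)) auto
        then show "f t (v t) - e/2 \<le> f t y" by linarith
      qed
      moreover have "h m t \<le> f t (v t) + e/2"
      proof (rule h_le[OF t], intro allI impI)
        fix y assume "0 \<le> y" "\<bar>y - V m t\<bar> \<le> \<eta> m"
        then have "\<bar>f t y - f t (v t)\<bar> < e / 2" using elim by (intro d(2)) auto
        then show "f t y \<le> f t (v t) + e/2" by linarith
      qed
      ultimately show ?case using e unfolding dist_real_def by linarith
    qed
  qed
  then show ?thesis by (intro tendsto_intros)
qed

text \<open>Eventually \<open>h m t\<close> samples only states within \<open>e\<close> of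
  \<open>v t\<close>, so it inherits the bound \<open>C / g t\<close>. If \<open>g t = 0\<close>,
  then \<open>q m t = 0\<close>, and the hypothesis at \<open>y = v t\<close> gives
  \<open>0 \<le> C\<close>.\<close>

lemma q_eventually_le:
  assumes t: "t \<in> {0..1}" and e: "0 < e"
    and B: "\<And>y. 0 \<le> y \<Longrightarrow> \<bar>y - v t\<bar> \<le> e \<Longrightarrow> g t * f t y \<le> C"
  shows "\<exists>n. p n t \<le> C"
proof -
  obtain n where n: "\<And>m y. n \<le> m \<Longrightarrow> \<bar>y - V m t\<bar> \<le> \<eta> m \<Longrightarrow> \<bar>y - v t\<bar> < e"
    using eventually_near[OF t e] unfolding eventually_sequentially by blast
  have "q m t \<le> C" if m: "n \<le> m" for m
  proof (cases "g t = 0")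
    case True
    then show ?thesis using B[of "v t"] v_nonneg[OF t] e by simp
  next
    case False
    then have gt: "g t > 0" using g_nonneg[OF t] by simp
    have "h m t \<le> C / g t"
    proof (rule h_le[OF t], intro allI impI)
      fix y assume "0 \<le> y" "\<bar>y - V m t\<bar> \<le> \<eta> m"
      then show "f t y \<le> C / g t"
        using B[of y] n[OF m, of y] gt by (simp add: pos_le_divide_eq mult.commute)
    qed
    then show ?thesis using gt by (simp add: pos_le_divide_eq mult.commute)
  qed
  then have "p n t \<le> C" unfolding p_def by (intro cSUP_least) auto
  then show ?thesis by blast
qed

lemma q_eventually_ge:
  assumes t: "t \<in> {0..1}" and e: "0 < e"
    and B: "\<And>y. 0 \<le> y \<Longrightarrow> \<bar>y - v t\<bar> \<le> e \<Longrightarrow> C \<le> g t * f t y"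
  shows "\<exists>n. C \<le> l n t"
proof -
  obtain n where n: "\<And>m y. n \<le> m \<Longrightarrow> \<bar>y - V m t\<bar> \<le> \<eta> m \<Longrightarrow> \<bar>y - v t\<bar> < e"
    using eventually_near[OF t e] unfolding eventually_sequentially by blast
  have "C \<le> q m t" if m: "n \<le> m" for m
  proof (cases "g t = 0")
    case True
    then show ?thesis using B[of "v t"] v_nonneg[OF t] e by simp
  next
    case False
    then have gt: "g t > 0" using g_nonneg[OF t] by simp
    have "C / g t \<le> h m t"
    proof (rule h_ge[OF t], intro allI impI)
      fix y assume "0 \<le> y" "\<bar>y - V m t\<bar> \<le> \<eta> m"
      then show "C / g t \<le> f t y"
        using B[of y] n[OF m, of y] gt by (simp add: pos_divide_le_eq mult.commute)
    qed
    then show ?thesis using gt by (simp add: pos_divide_le_eq mult.commute)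
  qed
  then have "C \<le> l n t" unfolding l_def by (intro cINF_greatest) auto
  then show ?thesis by blast
qed

text \<open>At almost every contact point where \<open>y'\<close> has derivative \<open>d\<close>,
  \<open>w\<close> has derivative \<open>-d\<close>. For a viable curve this is the claimed value.
  For an inviable one the neighbourhood inequality pushes a tail envelope past \<open>-d\<close> by
  \<open>psi t > 0\<close>, although \<open>w_derivative_AE\<close> keeps \<open>-d\<close> between
  the envelopes; the claim then holds vacuously off a null set.\<close>

lemma curve_contact_AE:
  assumes rs: "{r..s} \<subseteq> {0..1}" and adm: "admissible_curve g f r s y"
  shows "\<exists>N. negligible N \<and>
    (\<forall>t\<in>{0<..<1} \<inter> {r..s} - N. v t = y t \<longrightarrow> (w has_real_derivative g t * f t (v t)) (at t))"
proof -
  obtain y' where y': "W21_on r s y y'" and alt: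
       "(AE t in lebesgue_on {r..s}. (y' has_real_derivative (- g t * f t (y t))) (at t)) \<or>
        (\<exists>e>0. \<exists>psi. (AE t in lebesgue_on {r..s}. psi t > 0) \<and>
           ((AE t in lebesgue_on {r..s}. \<exists>d. (y' has_real_derivative d) (at t) \<and>
               (\<forall>z\<in>{y t - e..y t + e}. z \<ge> 0 \<longrightarrow> d + psi t < - g t * f t z))
            \<or>
            (AE t in lebesgue_on {r..s}. \<exists>d. (y' has_real_derivative d) (at t) \<and>
               (\<forall>z\<in>{y t - e..y t + e}. z \<ge> 0 \<longrightarrow> d - psi t > - g t * f t z))))"
    using adm unfolding admissible_curve_def by blast
  obtain N1 where N1: "negligible N1"
    "\<And>t d. t \<in> {r..s} - N1 \<Longrightarrow> v t = y t \<Longrightarrow> (y' has_real_derivative d) (at t) \<Longrightarrow>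
       ((\<lambda>t. alpha * x - w t) has_real_derivative d) (at t)"
  proof (rule second_derivative_eq_on_contact_set[of r s v "\<lambda>t. alpha * x - w t" y y' "\<lambda>t. R * g t"])
    show "(v has_real_derivative alpha * x - w t) (at t within {r..s})" if "t \<in> {r..s}" for t
      using v_derivative[of t] that rs by (intro DERIV_subset[OF _ rs]) auto
    show "continuous_on {r..s} (\<lambda>t. alpha * x - w t)"
      by (intro continuous_intros continuous_on_subset[OF continuous_w rs])
    show "(\<lambda>t. R * g t) absolutely_integrable_on {r..s}"
      by (rule set_integrable_subset[OF Rg_int]) (use rs in auto)
    show "0 \<le> R * g t" if "t \<in> {r..s}" for t
      using g_nonneg[of t] R_nonneg that rs by auto
    show "\<bar>(alpha * x - w b) - (alpha * x - w a)\<bar> \<le> integral {a..b} (\<lambda>t. R * g t)"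
      if "r \<le> a" "a \<le> b" "b \<le> s" for a b
    proof -
      have "a \<in> {r..s}" "b \<in> {r..s}" using that by auto
      then have "0 \<le> a" "b \<le> 1" using rs by auto
      then show ?thesis using w_abs_diff[of a b] that by (simp add: abs_minus_commute)
    qed
  qed (use y' in \<open>auto simp: W21_on_def\<close>)
  have contact: "(w has_real_derivative - d) (at t)"
    if "t \<in> {r..s} - N1" "v t = y t" "(y' has_real_derivative d) (at t)" for t d
    using DERIV_diff[OF DERIV_const[of "alpha * x"] N1(2)[OF that]] by simp
  obtain N2 where N2: "negligible N2"
    "\<And>t D n. t \<in> {0<..<1} - N2 \<Longrightarrow> (w has_real_derivative D) (at t) \<Longrightarrow> l n t \<le> D \<and> D \<le> p n t"
    by (rule w_derivative_AE) blast
  have AE: "\<exists>M. negligible M \<and> (\<forall>t\<in>{r..s} - M. Q t)" if "AE t in lebesgue_on {r..s}. Q t" for Q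
    using that by (subst (asm) AE_lebesgue_on_iff_negligible) auto
  show ?thesis
    using alt
  proof (elim disjE exE conjE)
    assume "AE t in lebesgue_on {r..s}. (y' has_real_derivative (- g t * f t (y t))) (at t)"
    then obtain M where M: "negligible M" "\<forall>t\<in>{r..s} - M. (y' has_real_derivative (- g t * f t (y t))) (at t)"
      using AE by blast
    have "(w has_real_derivative g t * f t (v t)) (at t)" if "t \<in> {r..s} - (N1 \<union> M)" "v t = y t" for t
      using contact[of t "- g t * f t (y t)"] M that by auto
    then show ?thesis using N1(1) M(1) by (intro exI[of _ "N1 \<union> M"]) auto
  next
    fix e psi assume e: "0 < e" and psi: "AE t in lebesgue_on {r..s}. psi t > (0::real)"
      and inv: "AE t in lebesgue_on {r..s}. \<exists>d. (y' has_real_derivative d) (at t) \<and>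
               (\<forall>z\<in>{y t - e..y t + e}. z \<ge> 0 \<longrightarrow> d + psi t < - g t * f t z)"
    obtain M1 where M1: "negligible M1" "\<forall>t\<in>{r..s} - M1. 0 < psi t"
      using AE[OF psi] by blast
    obtain M2 where M2: "negligible M2" "\<forall>t\<in>{r..s} - M2. \<exists>d. (y' has_real_derivative d) (at t) \<and>
               (\<forall>z\<in>{y t - e..y t + e}. z \<ge> 0 \<longrightarrow> d + psi t < - g t * f t z)"
      using AE[OF inv] by (elim exE conjE)
    have False if t: "t \<in> {0<..<1} \<inter> {r..s} - (N1 \<union> N2 \<union> M1 \<union> M2)" and vy: "v t = y t" for t
    proof -
      obtain d where d: "(y' has_real_derivative d) (at t)"
          "\<And>z. z \<in> {y t - e..y t + e} \<Longrightarrow> z \<ge> 0 \<Longrightarrow> d + psi t < - g t * f t z"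
        using M2 t by blast
      \<comment> \<open>The width \<open>e\<close> of the inviable strip matters here: the
        approximations sample \<open>f t\<close> beside the curve, not on it.\<close>
      have "\<exists>n. p n t \<le> - d - psi t"
      proof (rule q_eventually_le[OF _ e])
        show "g t * f t z \<le> - d - psi t" if "0 \<le> z" "\<bar>z - v t\<bar> \<le> e" for z
          using d(2)[of z] that vy by (auto simp: abs_le_iff)
      qed (use t in auto)
      moreover have "- d \<le> p n t" for n
        using N2(2)[OF _ contact[OF _ vy d(1)]] t by blast
      moreover have "0 < psi t" using M1 t by blast
      ultimately show False by (smt (verit))
    qed
    moreover have "negligible (N1 \<union> N2 \<union> M1 \<union> M2)"
      by (intro negligible_Un N1 N2 M1 M2)
    ultimately show ?thesis by blast
  next
    fix e psi assume e: "0 < e" and psi: "AE t in lebesgue_on {r..s}. psi t > (0::real)"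
      and inv: "AE t in lebesgue_on {r..s}. \<exists>d. (y' has_real_derivative d) (at t) \<and>
               (\<forall>z\<in>{y t - e..y t + e}. z \<ge> 0 \<longrightarrow> d - psi t > - g t * f t z)"
    obtain M1 where M1: "negligible M1" "\<forall>t\<in>{r..s} - M1. 0 < psi t"
      using AE[OF psi] by blast
    obtain M2 where M2: "negligible M2" "\<forall>t\<in>{r..s} - M2. \<exists>d. (y' has_real_derivative d) (at t) \<and>
               (\<forall>z\<in>{y t - e..y t + e}. z \<ge> 0 \<longrightarrow> d - psi t > - g t * f t z)"
      using AE[OF inv] by (elim exE conjE)
    have False if t: "t \<in> {0<..<1} \<inter> {r..s} - (N1 \<union> N2 \<union> M1 \<union> M2)" and vy: "v t = y t" for t
    proof -
      obtain d where d: "(y' has_real_derivative d) (at t)"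
          "\<And>z. z \<in> {y t - e..y t + e} \<Longrightarrow> z \<ge> 0 \<Longrightarrow> d - psi t > - g t * f t z"
        using M2 t by blast
      have "\<exists>n. - d + psi t \<le> l n t"
      proof (rule q_eventually_ge[OF _ e])
        show "- d + psi t \<le> g t * f t z" if "0 \<le> z" "\<bar>z - v t\<bar> \<le> e" for z
          using d(2)[of z] that vy by (auto simp: abs_le_iff)
      qed (use t in auto)
      moreover have "l n t \<le> - d" for n
        using N2(2)[OF _ contact[OF _ vy d(1)]] t by blast
      moreover have "0 < psi t" using M1 t by blast
      ultimately show False by (smt (verit))
    qed
    moreover have "negligible (N1 \<union> N2 \<union> M1 \<union> M2)"
      by (intro negligible_Un N1 N2 M1 M2)
    ultimately show ?thesis by blast
  qed
qed

lemma v_solves: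
  fixes an bn :: "nat \<Rightarrow> real" and gc :: "nat \<Rightarrow> real \<Rightarrow> real"
  assumes curves: "\<And>n. {an n..bn n} \<subseteq> {0..1} \<and> admissible_curve g f (an n) (bn n) (gc n)"
    and f_cont: "AE t in lebesgue_on {0..1}.
                   \<forall>u\<in>{0..} - {gc n t | n. t \<in> {an n..bn n}}. continuous (at u within {0..}) (f t)"
  shows "AE t in lebesgue_on {0..1}. ((\<lambda>t. alpha * x - w t) has_real_derivative - g t * f t (v t)) (at t)"
proof -
  obtain M where M: "negligible M"
    "\<And>t. t \<in> {0..1} - M \<Longrightarrow> \<forall>u\<in>{0..} - {gc n t | n. t \<in> {an n..bn n}}. continuous (at u within {0..}) (f t)"
    using f_cont by (subst (asm) AE_lebesgue_on_iff_negligible) auto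
  have "\<exists>N. negligible N \<and> (\<forall>t\<in>{0<..<1} \<inter> {an n..bn n} - N. v t = gc n t \<longrightarrow>
      (w has_real_derivative g t * f t (v t)) (at t))" for n
    using curve_contact_AE[of "an n" "bn n" "gc n"] curves by blast
  then have "\<exists>N. \<forall>n. negligible (N n) \<and> (\<forall>t\<in>{0<..<1} \<inter> {an n..bn n} - N n. v t = gc n t \<longrightarrow>
      (w has_real_derivative g t * f t (v t)) (at t))"
    by (intro choice allI)
  then obtain N where N: "\<And>n. negligible (N n)"
    "\<And>n t. t \<in> {0<..<1} \<inter> {an n..bn n} - N n \<Longrightarrow> v t = gc n t \<Longrightarrow> (w has_real_derivative g t * f t (v t)) (at t)"
    by blast
  obtain N' where N': "negligible N'"
    "\<And>t Q. t \<in> {0<..<1} - N' \<Longrightarrow> (\<lambda>m. q m t) \<longlonglongrightarrow> Q \<Longrightarrow> (w has_real_derivative Q) (at t)"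
    by (rule w_derivative_AE) blast
  let ?Z = "M \<union> (\<Union>n. N n) \<union> N' \<union> {0, 1}"
  have "((\<lambda>t. alpha * x - w t) has_real_derivative - g t * f t (v t)) (at t)" if t: "t \<in> {0..1} - ?Z" for t
  proof -
    have t01: "t \<in> {0<..<1}" "t \<in> {0..1}" using t by auto
    have "(w has_real_derivative g t * f t (v t)) (at t)"
    proof (cases "\<exists>n. t \<in> {an n..bn n} \<and> v t = gc n t")
      case True
      then show ?thesis using N(2) t t01 by blast
    next
      case False
      then have "v t \<in> {0..} - {gc n t | n. t \<in> {an n..bn n}}" using v_nonneg[OF t01(2)] by auto
      then have "continuous (at (v t) within {0..}) (f t)" using M(2)[of t] t by blast
      then show ?thesis using N'(2)[of t] q_tendsto[OF t01(2)] t t01 by blast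
    qed
    then show ?thesis using DERIV_diff[OF DERIV_const[of "alpha * x"]] by fastforce
  qed
  moreover have "negligible ?Z"
    using M(1) N'(1) negligible_Union_nat[of N] N(1) by (intro negligible_Un) auto
  ultimately have "\<exists>N. negligible N \<and> (\<forall>t\<in>{0..1} - N.
      ((\<lambda>t. alpha * x - w t) has_real_derivative - g t * f t (v t)) (at t))"
    by blast
  then show ?thesis by (simp add: AE_lebesgue_on_iff_negligible)
qed

end

section \<open>Thresholds, extremal Green integrals and compactness\<close>

lemma cond_I1E:
  assumes "cond_I1 f m \<rho>" "0 < \<rho>" "\<And>t u. t \<in> {0..1} \<Longrightarrow> 0 \<le> u \<Longrightarrow> 0 \<le> f t u"
  obtains \<epsilon> \<theta> where "0 < \<epsilon>" "0 \<le> \<theta>" "\<theta> < m"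
    "\<And>t u. t \<in> {0..1} \<Longrightarrow> 0 \<le> u \<Longrightarrow> u \<le> \<rho> + \<epsilon> \<Longrightarrow> f t u \<le> \<theta> * \<rho>"
proof -
  obtain \<epsilon> where \<epsilon>: "0 < \<epsilon>" and S: "bdd_above {f t u / \<rho> | t u. 0 \<le> t \<and> t \<le> 1 \<and> 0 \<le> u \<and> u \<le> \<rho> + \<epsilon>}"
    "Sup {f t u / \<rho> | t u. 0 \<le> t \<and> t \<le> 1 \<and> 0 \<le> u \<and> u \<le> \<rho> + \<epsilon>} < m"
    using assms(1) unfolding cond_I1_def Let_def by blast
  define \<theta> where "\<theta> = Sup {f t u / \<rho> | t u. 0 \<le> t \<and> t \<le> 1 \<and> 0 \<le> u \<and> u \<le> \<rho> + \<epsilon>}"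
  have le: "f t u / \<rho> \<le> \<theta>" if "t \<in> {0..1}" "0 \<le> u" "u \<le> \<rho> + \<epsilon>" for t u
    unfolding \<theta>_def using that by (intro cSup_upper[OF _ S(1)]) auto
  have "0 \<le> f 0 0 / \<rho>" using assms by auto
  also have "\<dots> \<le> \<theta>" using \<epsilon> assms(2) by (intro le) auto
  finally have "0 \<le> \<theta>" .
  then show thesis
    using that[of \<epsilon> \<theta>] \<epsilon> S(2) le assms(2) by (simp add: \<theta>_def[symmetric] pos_divide_le_eq)
qed

lemma cond_I0E:
  assumes "cond_I0 f a b c M \<rho>" "0 < \<rho>"
  obtains \<epsilon> \<theta> where "0 < \<epsilon>" "M < \<theta>"
    "\<And>t u. t \<in> {a..b} \<Longrightarrow> 0 \<le> u \<Longrightarrow> c * (\<rho> - \<epsilon>) \<le> u \<Longrightarrow> u \<le> \<rho> / c + \<epsilon> \<Longrightarrow> \<theta> * \<rho> \<le> f t u"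
proof -
  obtain \<epsilon> where \<epsilon>: "0 < \<epsilon>" and S: "bdd_below {f t u / \<rho> | t u. a \<le> t \<and> t \<le> b \<and> 0 \<le> u \<and> c * (\<rho> - \<epsilon>) \<le> u \<and> u \<le> \<rho> / c + \<epsilon>}"
    "M < Inf {f t u / \<rho> | t u. a \<le> t \<and> t \<le> b \<and> 0 \<le> u \<and> c * (\<rho> - \<epsilon>) \<le> u \<and> u \<le> \<rho> / c + \<epsilon>}"
    using assms(1) unfolding cond_I0_def Let_def by blast
  define \<theta> where "\<theta> = Inf {f t u / \<rho> | t u. a \<le> t \<and> t \<le> b \<and> 0 \<le> u \<and> c * (\<rho> - \<epsilon>) \<le> u \<and> u \<le> \<rho> / c + \<epsilon>}"
  have "\<theta> \<le> f t u / \<rho>" if "t \<in> {a..b}" "0 \<le> u" "c * (\<rho> - \<epsilon>) \<le> u" "u \<le> \<rho> / c + \<epsilon>" for t u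
    unfolding \<theta>_def using that by (intro cInf_lower[OF _ S(1)]) auto
  then show thesis
    using that[of \<epsilon> \<theta>] \<epsilon> S(2) assms(2) by (simp add: \<theta>_def[symmetric] pos_le_divide_eq)
qed

text \<open>A real supremum is informative only for sets bounded above; the integral of the diagonal
  \<open>G s s * g s\<close> provides the bound.\<close>

lemma (in sturm_liouville) green_integral_le_sup:
  assumes g: "g absolutely_integrable_on {0..1}" and g0: "\<And>t. t \<in> {0..1} \<Longrightarrow> 0 \<le> g t" and t: "t \<in> {0..1}"
  shows "integral {0..1} (\<lambda>s. G t s * g s) \<le> (SUP t\<in>{0..1}. integral {0..1} (\<lambda>s. G t s * g s))"
proof (rule cSUP_upper[OF t])
  have diag: "continuous_on {0..1} (\<lambda>s. G s s)"
    unfolding green_eq_ramp by (intro continuous_intros) (use Gam_pos in auto)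
  show "bdd_above ((\<lambda>t. integral {0..1} (\<lambda>s. G t s * g s)) ` {0..1})"
  proof (rule bdd_aboveI2)
    fix t :: real assume t: "t \<in> {0..1}"
    show "integral {0..1} (\<lambda>s. G t s * g s) \<le> integral {0..1} (\<lambda>s. G s s * g s)"
      using green_le_diagonal[OF t] g0
      by (intro integral_le integrable_continuous_mult continuous_green diag g mult_right_mono) auto
  qed
qed

lemma (in sturm_liouville_cone) green_integral_inf:
  assumes g: "g absolutely_integrable_on {0..1}" and g0: "\<And>t. t \<in> {0..1} \<Longrightarrow> 0 \<le> g t"
    and gpos: "0 < integral {a..b} g"
  shows "0 < (INF t\<in>{a..b}. integral {a..b} (\<lambda>s. G t s * g s))"
    and "\<And>t. t \<in> {a..b} \<Longrightarrow>
      (INF t\<in>{a..b}. integral {a..b} (\<lambda>s. G t s * g s)) \<le> integral {a..b} (\<lambda>s. G t s * g s)"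
proof -
  define \<kappa> where "\<kappa> = (beta + alpha * a) * (gam + delta - gam * b) / Gam"
  have \<kappa>: "\<kappa> > 0" using end_pos Gam_pos by (simp add: \<kappa>_def)
  have sub: "{a..b} \<subseteq> {0..1}" using ab by auto
  have gab: "g absolutely_integrable_on {a..b}"
    by (rule set_integrable_subset[OF g]) (use sub in auto)
  have lower: "\<kappa> * integral {a..b} g \<le> integral {a..b} (\<lambda>s. G t s * g s)" if t: "t \<in> {a..b}" for t
  proof -
    have "integral {a..b} (\<lambda>s. \<kappa> * g s) \<le> integral {a..b} (\<lambda>s. G t s * g s)"
      using green_lower_bound[OF t] g0 sub
      by (intro integral_le integrable_continuous_mult continuous_green continuous_on_const gab mult_right_mono)
        (auto simp: \<kappa>_def)
    then show ?thesis by simp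
  qed
  have "0 < \<kappa> * integral {a..b} g" using \<kappa> gpos by simp
  also have "\<dots> \<le> (INF t\<in>{a..b}. integral {a..b} (\<lambda>s. G t s * g s))"
    using lower ab by (intro cINF_greatest) auto
  finally show "0 < (INF t\<in>{a..b}. integral {a..b} (\<lambda>s. G t s * g s))" .
  show "(INF t\<in>{a..b}. integral {a..b} (\<lambda>s. G t s * g s)) \<le> integral {a..b} (\<lambda>s. G t s * g s)"
    if "t \<in> {a..b}" for t
    using lower that by (intro cINF_lower bdd_belowI2) auto
qed

lemma abs_integral_diff_mono:
  fixes g :: "real \<Rightarrow> real"
  assumes "g integrable_on {0..1}" "q integrable_on {0..1}"
    and "\<And>s. s \<in> {0..1} \<Longrightarrow> 0 \<le> q s \<and> q s \<le> g s" and "t \<in> {0..1}" "t' \<in> {0..1}"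
  shows "\<bar>integral {0..t} q - integral {0..t'} q\<bar> \<le> \<bar>integral {0..t} g - integral {0..t'} g\<bar>"
proof -
  have *: "\<bar>integral {0..y} q - integral {0..z} q\<bar> \<le> \<bar>integral {0..y} g - integral {0..z} g\<bar>"
    if "0 \<le> z" "z \<le> y" "y \<le> 1" for y z
  proof -
    have sub: "{z..y} \<subseteq> {0..1}" using that by auto
    have "0 \<le> integral {z..y} q"
      using assms(3) sub by (intro Henstock_Kurzweil_Integration.integral_nonneg integrable_on_subinterval[OF assms(2)]) auto
    moreover have "integral {z..y} q \<le> integral {z..y} g"
      using assms(3) sub by (intro integral_le integrable_on_subinterval[OF assms(1)] integrable_on_subinterval[OF assms(2)]) auto
    ultimately show ?thesis
      unfolding integral_diff_real[OF assms(1) that] integral_diff_real[OF assms(2) that] by simp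
  qed
  show ?thesis
  proof (cases "t' \<le> t")
    case True
    then show ?thesis using *[of t' t] assms by simp
  next
    case False
    then show ?thesis using *[of t t'] assms by (simp add: abs_minus_commute)
  qed
qed

text \<open>Domination by \<open>g\<close> bounds the increments of all primitives by those of the
  primitive of \<open>g\<close>, which gives a common modulus of continuity. Arzela-Ascoli yields
  \<open>w\<close>, and a further subsequence makes the parameters converge.\<close>

lemma compact_extraction:
  fixes q :: "nat \<Rightarrow> real \<Rightarrow> real" and xs :: "nat \<Rightarrow> real"
  assumes g: "g integrable_on {0..1}" and q: "\<And>n. q n integrable_on {0..1}"
    and qg: "\<And>n s. s \<in> {0..1} \<Longrightarrow> 0 \<le> q n s \<and> q n s \<le> g s"
    and xs: "\<And>n. xs n \<in> {0..X}"
  obtains \<phi> w x where "strict_mono (\<phi> :: nat \<Rightarrow> nat)"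
    "uniform_limit {0..1} (\<lambda>n t. integral {0..t} (q (\<phi> n))) w sequentially" "(xs \<circ> \<phi>) \<longlonglongrightarrow> x"
proof -
  have cont: "continuous_on {0..1} (\<lambda>t. integral {0..t} g)"
    by (rule indefinite_integral_continuous_1[OF g])
  obtain w \<kappa> where \<kappa>: "strict_mono (\<kappa> :: nat \<Rightarrow> nat)"
    "\<And>e. 0 < e \<Longrightarrow> \<exists>N. \<forall>n t. n \<ge> N \<and> t \<in> {0..1} \<longrightarrow> norm (integral {0..t} (q (\<kappa> n)) - w t) < e"
  proof (rule Arzela_Ascoli[of "{0..1::real}" "\<lambda>n t. integral {0..t} (q n)" "integral {0..1} g"])
    show "norm (integral {0..t} (q n)) \<le> integral {0..1} g" if t: "t \<in> {0..1}" for n t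
    proof -
      have g0: "0 \<le> g s" if "s \<in> {0..1}" for s
        using qg[OF that, of 0] by linarith
      have gt: "g integrable_on {0..t}" "{0..t} \<subseteq> {0..1}"
        using t by (auto intro: integrable_on_subinterval[OF g])
      have "\<bar>integral {0..t} (q n) - integral {0..0} (q n)\<bar> \<le> \<bar>integral {0..t} g - integral {0..0} g\<bar>"
        using t by (intro abs_integral_diff_mono[OF g q qg]) auto
      also have "\<dots> = integral {0..t} g"
        using gt g0 Henstock_Kurzweil_Integration.integral_nonneg[OF gt(1)] by (simp add: subset_iff)
      also have "\<dots> \<le> integral {0..1} g"
        using gt g g0 by (intro integral_subset_le) auto
      finally show ?thesis by simp
    qed
    show "\<exists>d. 0 < d \<and> (\<forall>n y. y \<in> {0..1} \<and> norm (t - y) < d \<longrightarrow>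
        norm (integral {0..t} (q n) - integral {0..y} (q n)) < e)" if t: "t \<in> {0..1}" and e: "0 < e" for t e
    proof -
      obtain d where d: "0 < d" "\<And>y. y \<in> {0..1} \<Longrightarrow> dist y t < d \<Longrightarrow> dist (integral {0..y} g) (integral {0..t} g) < e"
        using cont t e unfolding continuous_on_iff by meson
      have "norm (integral {0..t} (q n) - integral {0..y} (q n)) < e" if "y \<in> {0..1}" "norm (t - y) < d" for n y
        using abs_integral_diff_mono[OF g q[of n] qg t that(1)] d(2)[OF that(1)] that(2)
        by (auto simp: dist_real_def abs_minus_commute)
      then show ?thesis using d(1) by blast
    qed
  qed (auto intro: that)
  have "\<forall>n. (xs \<circ> \<kappa>) n \<in> {0..X}" using xs by simp
  then obtain x r where r: "strict_mono (r :: nat \<Rightarrow> nat)" "((xs \<circ> \<kappa>) \<circ> r) \<longlonglongrightarrow> x"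
    using compact_Icc[of 0 X] unfolding compact_def by blast
  have ul: "uniform_limit {0..1} (\<lambda>n t. integral {0..t} (q (\<kappa> n))) w sequentially"
    by (rule uniform_limitI) (use \<kappa>(2) in \<open>fastforce simp: eventually_sequentially dist_norm\<close>)
  have "uniform_limit {0..1} (\<lambda>n t. integral {0..t} (q ((\<kappa> \<circ> r) n))) w sequentially"
    using filterlim_compose[OF ul filterlim_subseq[OF r(1)]] by (simp add: o_def)
  then show thesis
    using that[of "\<kappa> \<circ> r"] r strict_mono_o[OF \<kappa>(1) r(1)] by (simp add: o_assoc)
qed

text \<open>In the definition \<open>g\<close> occurs only under almost-everywhere quantifiers,
  which do not see a null set.\<close>

lemma admissible_curve_cong:
  assumes adm: "admissible_curve g f r s y" and N: "negligible N" "\<And>t. t \<notin> N \<Longrightarrow> g' t = g t"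
  shows "admissible_curve g' f r s y"
proof -
  have "AE t in lebesgue. t \<notin> N" using N(1) by (simp add: negligible_iff_null_sets AE_not_in)
  then have "AE t in lebesgue_on {r..s}. t \<notin> N"
    by (auto simp: AE_restrict_space_iff elim: eventually_mono)
  then have "AE t in lebesgue_on {r..s}. g' t = g t" by eventually_elim (rule N(2))
  then have eq: "(AE t in lebesgue_on {r..s}. Q (g' t) t) = (AE t in lebesgue_on {r..s}. Q (g t) t)" for Q
    by (intro eventually_subst) (auto elim: eventually_mono)
  note e1 = eq[of "\<lambda>z t. (y' has_real_derivative (- z * f t (y t))) (at t)" for y']
  note e2 = eq[of "\<lambda>z t. \<exists>d. (y' has_real_derivative d) (at t) \<and>
               (\<forall>u\<in>{y t - e..y t + e}. u \<ge> 0 \<longrightarrow> d + psi t < - z * f t u)" for y' e psi]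
  note e3 = eq[of "\<lambda>z t. \<exists>d. (y' has_real_derivative d) (at t) \<and>
               (\<forall>u\<in>{y t - e..y t + e}. u \<ge> 0 \<longrightarrow> d - psi t > - z * f t u)" for y' e psi]
  show ?thesis
    using adm unfolding admissible_curve_def e1 e2 e3 .
qed


section \<open>The existence theorem\<close>

theorem theorem6:
  fixes alpha beta gam delta a b c :: real
    and f :: "real \<Rightarrow> real \<Rightarrow> real" and g :: "real \<Rightarrow> real"
    and an bn :: "nat \<Rightarrow> real" and gc :: "nat \<Rightarrow> real \<Rightarrow> real"
  assumes params: "alpha \<ge> 0" "beta \<ge> 0" "gam \<ge> 0" "delta \<ge> 0"
    and Gam_pos: "gam * beta + alpha * gam + alpha * delta > 0"
    and ab: "a \<in> {0..1}" "b \<in> {0..1}" "alpha = 0 \<or> - beta / alpha < a" "a < b"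
            "gam = 0 \<or> b < 1 + delta / gam"
    and c_def: "c = min ((gam + delta - gam * b) / (gam + delta)) ((beta + alpha * a) / (alpha + beta))"
    and f_nonneg: "\<forall>t\<in>{0..1}. \<forall>u\<ge>0. f t u \<ge> 0"
    and f_meas: "\<forall>u. continuous_on {0..1} u \<and> (\<forall>t\<in>{0..1}. u t \<ge> 0) \<longrightarrow>
                   (\<lambda>t. f t (u t)) \<in> borel_measurable (lebesgue_on {0..1})"
    and f_bdd: "\<forall>r>0. \<exists>R>0. AE t in lebesgue_on {0..1}. \<forall>u\<in>{0..r}. f t u \<le> R"
    and curves: "\<forall>n. {an n..bn n} \<subseteq> {0..1} \<and> admissible_curve g f (an n) (bn n) (gc n)"
    and f_cont: "AE t in lebesgue_on {0..1}.
                   \<forall>u\<in>{0..} - {gc n t | n. t \<in> {an n..bn n}}. continuous (at u within {0..}) (f t)"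
    and g_L1: "g absolutely_integrable_on {0..1}"
    and g_nonneg: "AE t in lebesgue_on {0..1}. g t \<ge> 0"
    and g_pos: "integral {a..b} g > 0"
    and rho: "(\<exists>rho1 rho2. 0 < rho1 \<and> 0 < rho2 \<and> rho1 / c < rho2 \<and>
                 cond_I0 f a b c (M_const alpha beta gam delta g a b) rho1 \<and>
                 cond_I1 f (m_const alpha beta gam delta g) rho2)
            \<or> (\<exists>rho1 rho2. 0 < rho1 \<and> 0 < rho2 \<and> rho1 < rho2 \<and>
                 cond_I1 f (m_const alpha beta gam delta g) rho1 \<and>
                 cond_I0 f a b c (M_const alpha beta gam delta g a b) rho2)"
  shows "\<exists>u u'. W21_on 0 1 u u' \<and>
           (AE t in lebesgue_on {0..1}. (u' has_real_derivative (- g t * f t (u t))) (at t)) \<and>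
           alpha * u 0 - beta * u' 0 = 0 \<and> gam * u 1 + delta * u' 1 = 0 \<and>
           (\<forall>t\<in>{0..1}. u t \<ge> 0) \<and> (\<exists>t\<in>{0..1}. u t \<noteq> 0)"
proof -
  interpret cone: sturm_liouville_cone alpha beta gam delta a b c
    by unfold_locales (use params Gam_pos ab c_def in auto)
  have f0: "0 \<le> f t u" if "t \<in> {0..1}" "0 \<le> u" for t u
    using f_nonneg that by blast
  obtain \<rho>1 \<rho>2 \<rho>p \<rho>m where \<rho>: "0 < \<rho>1" "\<rho>1 < \<rho>2"
    and alt: "\<rho>m = \<rho>1 \<and> \<rho>p = \<rho>2 \<or> \<rho>p = \<rho>1 \<and> \<rho>m = \<rho>2"
    and I1: "cond_I1 f (m_const alpha beta gam delta g) \<rho>p"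
    and I0: "cond_I0 f a b c (M_const alpha beta gam delta g a b) \<rho>m"
    using rho
  proof (elim disjE exE conjE)
    fix r1 r2 assume r: "0 < r1" "0 < r2" "r1 / c < r2"
      and "cond_I0 f a b c (M_const alpha beta gam delta g a b) r1"
        "cond_I1 f (m_const alpha beta gam delta g) r2"
    \<comment> \<open>Since \<open>c \<le> 1\<close>, case (a) also orders the levels as
      \<open>r1 < r2\<close>, and both cases differ only in which level carries which sign.\<close>
    moreover have "r1 \<le> r1 / c"
      using cone.c_bounds r by (simp add: pos_le_divide_eq mult_left_le)
    ultimately show thesis using that[of r1 r2 r1 r2] by auto
  next
    fix r1 r2 assume "0 < r1" "0 < r2" "r1 < r2"
        "cond_I1 f (m_const alpha beta gam delta g) r1"
        "cond_I0 f a b c (M_const alpha beta gam delta g a b) r2"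
    then show thesis using that[of r1 r2 r2 r1] by auto
  qed
  have \<rho>pm: "0 < \<rho>p" "0 < \<rho>m" using alt \<rho> by auto
  obtain P :: nat where P: "\<rho>2 \<le> real P" using real_arch_simple by blast
  then have "0 < real P" using \<rho> by linarith
  then obtain R where R: "0 < R" and fR: "AE t in lebesgue_on {0..1}. \<forall>u\<in>{0..real P}. f t u \<le> R"
    using f_bdd by blast
  obtain Z1 where Z1: "negligible Z1" "\<And>t. t \<in> {0..1} - Z1 \<Longrightarrow> 0 \<le> g t"
    using g_nonneg by (subst (asm) AE_lebesgue_on_iff_negligible) auto
  obtain Z2 where Z2: "negligible Z2" "\<And>t u. t \<in> {0..1} - Z2 \<Longrightarrow> u \<in> {0..real P} \<Longrightarrow> f t u \<le> R"
    using fR by (subst (asm) AE_lebesgue_on_iff_negligible) auto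
  define Z where "Z = Z1 \<union> Z2"
  have Z: "negligible Z" unfolding Z_def using Z1(1) Z2(1) by (rule negligible_Un)
  \<comment> \<open>Replacing \<open>g\<close> by \<open>0\<close> on a null set turns the a.e. bounds into pointwise ones.\<close>
  define g' where "g' t = (if t \<in> Z then 0 else g t)" for t
  have g'_int: "g' absolutely_integrable_on {0..1}"
    by (rule absolutely_integrable_spike[OF g_L1 Z]) (simp add: g'_def)
  have g'_nonneg: "0 \<le> g' t" if "t \<in> {0..1}" for t
    using Z1(2)[of t] that by (auto simp: g'_def Z_def)
  have g'f: "g' t * f t u \<le> R * g' t" if "t \<in> {0..1}" "0 \<le> u" "u \<le> real P" for t u
  proof (cases "t \<in> Z")
    case False
    then have "g' t * f t u \<le> g' t * R"
      using Z2(2)[of t u] that g'_nonneg[of t] by (intro mult_left_mono) (auto simp: Z_def)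
    then show ?thesis by (simp add: mult.commute)
  qed (simp add: g'_def)
  have spike: "integral S (\<lambda>s. \<phi> s * g s) = integral S (\<lambda>s. \<phi> s * g' s)" for S and \<phi> :: "real \<Rightarrow> real"
    by (rule integral_spike[OF Z]) (simp add: g'_def)
  have g'_pos: "0 < integral {a..b} g'"
    using g_pos spike[of "{a..b}" "\<lambda>_. 1"] by simp
  define \<sigma> where "\<sigma> = (SUP t\<in>{0..1}. integral {0..1} (\<lambda>s. cone.G t s * g' s))"
  define \<tau> where "\<tau> = (INF t\<in>{a..b}. integral {a..b} (\<lambda>s. cone.G t s * g' s))"
  \<comment> \<open>The thresholds are built from integrals, so they are the same for
    \<open>g\<close> and \<open>g'\<close>, and the growth conditions carry over.\<close>
  have m: "m_const alpha beta gam delta g = 1 / \<sigma>" and M: "M_const alpha beta gam delta g a b = 1 / \<tau>"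
    unfolding m_const_def M_const_def \<sigma>_def \<tau>_def spike by (rule refl)+
  have G\<sigma>: "integral {0..1} (\<lambda>s. cone.G t s * g' s) \<le> \<sigma>" if "t \<in> {0..1}" for t
    unfolding \<sigma>_def by (rule cone.green_integral_le_sup[OF g'_int g'_nonneg that])
  have \<tau>: "0 < \<tau>" and G\<tau>: "\<And>t. t \<in> {a..b} \<Longrightarrow> \<tau> \<le> integral {a..b} (\<lambda>s. cone.G t s * g' s)"
    unfolding \<tau>_def using cone.green_integral_inf[OF g'_int g'_nonneg g'_pos] by auto
  obtain \<epsilon>p \<theta>p where \<epsilon>p: "0 < \<epsilon>p" "0 \<le> \<theta>p" "\<theta>p < 1 / \<sigma>"
    "\<And>t u. t \<in> {0..1} \<Longrightarrow> 0 \<le> u \<Longrightarrow> u \<le> \<rho>p + \<epsilon>p \<Longrightarrow> f t u \<le> \<theta>p * \<rho>p"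
    using cond_I1E[OF I1 \<rho>pm(1) f0] unfolding m by blast
  \<comment> \<open>Positivity of \<sigma> is read off from
    \<open>0 \<le> \<theta>p < 1 / \<sigma>\<close>; this also rules out
    \<open>\<sigma> = 0\<close>, where \<open>1 / \<sigma>\<close> would be 0 by convention.\<close>
  have "0 < 1 / \<sigma>" using \<epsilon>p by linarith
  then have "0 < \<sigma>" by (simp add: zero_less_divide_iff)
  then have \<theta>p: "\<theta>p * \<sigma> < 1" using \<epsilon>p(3) by (simp add: pos_less_divide_eq)
  obtain \<epsilon>m \<theta>m where \<epsilon>m: "0 < \<epsilon>m" "1 / \<tau> < \<theta>m"
    "\<And>t u. t \<in> {a..b} \<Longrightarrow> 0 \<le> u \<Longrightarrow> c * (\<rho>m - \<epsilon>m) \<le> u \<Longrightarrow> u \<le> \<rho>m / c + \<epsilon>m \<Longrightarrow> \<theta>m * \<rho>m \<le> f t u"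
    using cond_I0E[OF I0 \<rho>pm(2)] unfolding M by blast
  have \<theta>m: "0 \<le> \<theta>m" "1 < \<theta>m * \<tau>"
  proof -
    show "1 < \<theta>m * \<tau>" using \<epsilon>m(2) \<tau> by (simp add: pos_divide_less_eq)
    have "0 < 1 / \<tau>" using \<tau> by simp
    then show "0 \<le> \<theta>m" using \<epsilon>m(2) by linarith
  qed
  define X where "X = (\<rho>2 + R * integral {0..1} g') / (alpha + beta)"
  define L where "L = alpha * X + R * integral {0..1} g'"
  \<comment> \<open>Exceeding the sum of all reciprocals satisfies every mesh requirement at once.
    The absolute value makes the second summand nonnegative without a sign for
    \<open>L + 1\<close>.\<close>
  obtain N0 :: nat where "1 / \<epsilon>p + \<bar>(L + 1) / (c * \<epsilon>m)\<bar> + 1 / \<epsilon>m + 1 / (b - a) \<le> real N0"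
    using real_arch_simple by blast
  moreover have "0 < 1 / \<epsilon>p" "0 < 1 / \<epsilon>m" "0 < 1 / (b - a)" "0 < c * \<epsilon>m"
    using \<epsilon>p \<epsilon>m ab cone.c_bounds by auto
  ultimately have N0: "1 / \<epsilon>p \<le> real N0" "(L + 1) / (c * \<epsilon>m) \<le> real N0" "1 / \<epsilon>m \<le> real N0" "1 / (b - a) \<le> real N0"
      "0 < real N0" and c\<epsilon>: "0 < c * \<epsilon>m"
    by linarith+
  \<comment> \<open>One predicate collects the whole outcome for mesh \<open>N0 + n\<close>, so that
    a single choice yields matching sequences \<open>xs\<close>, \<open>h\<close> and
    \<open>V\<close>.\<close>
  define good where "good n x h V \<longleftrightarrow> 0 \<le> x \<and> x \<le> X \<and>
    (\<lambda>s. g' s * h s) absolutely_integrable_on {0..1} \<and>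
    (\<forall>s\<in>{0..1}. 0 \<le> g' s * h s \<and> g' s * h s \<le> R * g' s) \<and>
    (\<forall>t. V t = (beta + alpha * t) * x - integral {0..1} (\<lambda>s. max 0 (t - s) * (g' s * h s))) \<and>
    (\<forall>t\<in>{0..1}. 0 \<le> V t) \<and>
    gam * V 1 + delta * (alpha * x - integral {0..1} (\<lambda>s. g' s * h s)) = 0 \<and>
    (\<exists>t\<in>{0..1}. \<rho>1 \<le> V t) \<and>
    (\<forall>s\<in>{0..1}. \<forall>lo. (\<forall>y\<ge>0. \<bar>y - V s\<bar> \<le> (L + 1) / real (N0 + n) \<longrightarrow> lo \<le> f s y) \<longrightarrow> lo \<le> h s) \<and>
    (\<forall>s\<in>{0..1}. \<forall>hi. (\<forall>y\<ge>0. \<bar>y - V s\<bar> \<le> (L + 1) / real (N0 + n) \<longrightarrow> f s y \<le> hi) \<longrightarrow> h s \<le> hi)"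
    for n :: nat and x :: real and h V :: "real \<Rightarrow> real"
  have ex: "\<exists>x h V. good n x h V" for n
  proof -
    have N: "real N0 \<le> real (N0 + n)" "0 < real (N0 + n)" using N0 by auto
    interpret shooting_cone alpha beta gam delta f g' R P "N0 + n" a b c
    proof unfold_locales
      show "(\<lambda>t. f t u) \<in> borel_measurable (lebesgue_on {0..1})" if "0 \<le> u" for u
        using f_meas[rule_format, of "\<lambda>_. u"] that by simp
    qed (use f0 g'_int g'_nonneg g'f R N in auto)
    show ?thesis
    proof (rule approximate_solution[OF \<rho> P alt L_def[unfolded X_def] _ _ _ _ \<epsilon>p(2) \<theta>p \<epsilon>p(4) G\<sigma> \<theta>m \<epsilon>m(3) G\<tau>])
      show "1 / real (N0 + n) \<le> \<epsilon>p" "1 / real (N0 + n) \<le> \<epsilon>m" "1 / real (N0 + n) \<le> b - a"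
        using order_trans[OF N0(1) N(1)] order_trans[OF N0(3) N(1)] order_trans[OF N0(4) N(1)] \<epsilon>p(1) \<epsilon>m(1) ab(4) N(2)
        by (simp_all add: pos_divide_le_eq mult.commute del: of_nat_add)
      show "(L + 1) / real (N0 + n) \<le> c * \<epsilon>m"
        using order_trans[OF N0(2) N(1)] c\<epsilon> N(2)
        by (simp add: pos_divide_le_eq mult.commute del: of_nat_add)
    qed (assumption | (unfold good_def X_def, intro exI conjI))+
  qed
  then have "\<exists>xs h V. \<forall>n. good n (xs n) (h n) (V n)" by metis
  then obtain xs h V where good: "\<And>n. good n (xs n) (h n) (V n)" by blast
  have Rg': "(\<lambda>s. R * g' s) integrable_on {0..1}"
    using absolutely_integrable_imp_integrable[OF g'_int] by (rule integrable_on_mult_right)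
  have qi: "(\<lambda>s. g' s * h n s) integrable_on {0..1}" for n
    using good[of n] absolutely_integrable_imp_integrable unfolding good_def by blast
  obtain \<phi> w x where \<phi>: "strict_mono (\<phi> :: nat \<Rightarrow> nat)"
    "uniform_limit {0..1} (\<lambda>n t. integral {0..t} (\<lambda>s. g' s * h (\<phi> n) s)) w sequentially" "(xs \<circ> \<phi>) \<longlonglongrightarrow> x"
  proof (rule compact_extraction[OF Rg' qi])
    show "0 \<le> g' s * h n s \<and> g' s * h n s \<le> R * g' s" if "s \<in> {0..1}" for n s
      using good[of n] that unfolding good_def by blast
    show "xs n \<in> {0..X}" for n using good[of n] unfolding good_def by auto
  qed
  define \<eta> where "\<eta> n = (L + 1) / real (N0 + \<phi> n)" for n
  have "\<eta> \<longlonglongrightarrow> 0"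
  proof -
    have "(\<lambda>n. (L + 1) / real (N0 + n)) \<longlonglongrightarrow> 0"
      using LIMSEQ_ignore_initial_segment[OF lim_const_over_n[of "L + 1"], of N0] by (simp add: add.commute)
    from LIMSEQ_subseq_LIMSEQ[OF this \<phi>(1)] show ?thesis by (simp add: \<eta>_def[abs_def] o_def)
  qed
  interpret lim: shooting_limit alpha beta gam delta f g' R \<rho>1 "xs \<circ> \<phi>" \<eta> "\<lambda>n. h (\<phi> n)" "\<lambda>n. V (\<phi> n)" w x
  proof unfold_locales
    fix n
    note G = good[of "\<phi> n", unfolded good_def]
    show "(\<lambda>s. g' s * h (\<phi> n) s) absolutely_integrable_on {0..1}" using G by blast
    show "0 \<le> g' s * h (\<phi> n) s \<and> g' s * h (\<phi> n) s \<le> R * g' s" if "s \<in> {0..1}" for s using G that by blast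
    show "V (\<phi> n) t = (beta + alpha * t) * (xs \<circ> \<phi>) n - integral {0..1} (\<lambda>s. max 0 (t - s) * (g' s * h (\<phi> n) s))" for t
      unfolding comp_apply using G by blast
    show "0 \<le> V (\<phi> n) t" if "t \<in> {0..1}" for t using G that by blast
    show "gam * V (\<phi> n) 1 + delta * (alpha * (xs \<circ> \<phi>) n - integral {0..1} (\<lambda>s. g' s * h (\<phi> n) s)) = 0"
      unfolding comp_apply using G by blast
    show "\<exists>t\<in>{0..1}. \<rho>1 \<le> V (\<phi> n) t" using G by blast
    show "lo \<le> h (\<phi> n) s" if "s \<in> {0..1}" "\<forall>y\<ge>0. \<bar>y - V (\<phi> n) s\<bar> \<le> \<eta> n \<longrightarrow> lo \<le> f s y" for s lo
      using G that unfolding \<eta>_def by blast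
    show "h (\<phi> n) s \<le> hi" if "s \<in> {0..1}" "\<forall>y\<ge>0. \<bar>y - V (\<phi> n) s\<bar> \<le> \<eta> n \<longrightarrow> f s y \<le> hi" for s hi
      using G that unfolding \<eta>_def by blast
  qed (use g'_int g'_nonneg R \<rho> \<phi> \<open>\<eta> \<longlonglongrightarrow> 0\<close> in auto)
  have curves': "{an n..bn n} \<subseteq> {0..1} \<and> admissible_curve g' f (an n) (bn n) (gc n)" for n
    using curves admissible_curve_cong[OF _ Z, of g f "an n" "bn n" "gc n" g'] by (auto simp: g'_def)
  obtain Z3 where Z3: "negligible Z3" "\<And>t. t \<in> {0..1} - Z3 \<Longrightarrow>
      ((\<lambda>t. alpha * x - w t) has_real_derivative - g' t * f t (lim.v t)) (at t)"
    using lim.v_solves[OF curves' f_cont] by (subst (asm) AE_lebesgue_on_iff_negligible) auto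
  \<comment> \<open>Off \<open>Z\<close> the modified weight equals \<open>g\<close>, so the
    original equation is recovered almost everywhere.\<close>
  have "\<forall>t\<in>{0..1} - (Z \<union> Z3). ((\<lambda>t. alpha * x - w t) has_real_derivative - g t * f t (lim.v t)) (at t)"
  proof
    fix t assume t: "t \<in> {0..1} - (Z \<union> Z3)"
    then show "((\<lambda>t. alpha * x - w t) has_real_derivative - g t * f t (lim.v t)) (at t)"
      using Z3(2)[of t] by (simp add: g'_def)
  qed
  then have "AE t in lebesgue_on {0..1}. ((\<lambda>t. alpha * x - w t) has_real_derivative - g t * f t (lim.v t)) (at t)"
    using negligible_Un[OF Z Z3(1)] by (subst AE_lebesgue_on_iff_negligible) (simp, blast)
  then show ?thesis
    using lim.v_W21 lim.v_left lim.v_right lim.v_nonneg lim.v_nontrivial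
    by (intro exI[of _ lim.v] exI[of _ "\<lambda>t. alpha * x - w t"]) auto
qed

end
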